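(* Let $E\subset\mathbb{R}^2$ be a closed, nondegenerate, convex quadrilateral and let $r\ge1$. With the mapped direct serendipity space $\mathcal{DS}_{r+1}^{\mathrm{map}}(E)$ and the reduced and full Arbogast-Correa spaces $\mathrm{AC}_r^{\mathrm{red}}(E)$ and $\mathrm{AC}_r(E)$ defined in the context, the sequences $$\mathbb{R}\hookrightarrow\mathcal{DS}_{r+1}^{\mathrm{map}}(E)\xrightarrow{\ \mathrm{curl}\ }\mathrm{AC}_r^{\mathrm{red}}(E)\xrightarrow{\ \mathrm{div}\ }\mathbb{P}_{r-1}(E)\to0$$ and $$\mathbb{R}\hookrightarrow\mathcal{DS}_{r+1}^{\mathrm{map}}(E)\xrightarrow{\ \mathrm{curl}\ }\mathrm{AC}_r(E)\xrightarrow{\ \mathrm{div}\ }\mathbb{P}_{r}(E)\to0$$ are (well defined and) exact, i.e. the image of each map equals the kernel of the next.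
   Context: $\mathbb{P}_k(E)$ is the space of polynomials of total degree at most $k$ restricted to $E$, $\mathbb{P}_k^2(E)$ the corresponding space of vector polynomials, and $\tilde{\mathbb{P}}_k(E)$ the homogeneous polynomials of degree $k$; $\mathbf{x}=(x_1,x_2)$ is the position vector. For a scalar $\phi$, $\mathrm{curl}\,\phi=(\partial\phi/\partial x_2,-\partial\phi/\partial x_1)$. $\mathbb{R}\hookrightarrow$ denotes inclusion of the constant functions. $E$ is nondegenerate if it does not degenerate to a triangle, segment or point. $\hat E=[-1,1]^2$ with coordinates $\hat{\mathbf{x}}=(\hat x_1,\hat x_2)$, and $\mathbf{F}_E:\hat E\to E$ is the bilinear bijective map taking the vertices of $\hat E$ to the vertices of $E$ (consecutive vertices to consecutive vertices). With $\mathbf{x}=\mathbf{F}_E(\hat{\mathbf{x}})$: for scalar $\hat\phi$ on $\hat E$, $F_E^0(\hat\phi)(\mathbf{x})=\hat\phi(\hat{\mathbf{x}})$; for vector-valued $\hat\psi$ on $\hat E$, the Piola map is $\mathbf{F}_E^1(\hat\psi)(\mathbf{x})=\frac{1}{J_E(\hat{\mathbf{x}})}D\mathbf{F}_E(\hat{\mathbf{x}})\,\hat\psi(\hat{\mathbf{x}})$, where $D\mathbf{F}_E$ is the Jacobian matrix of $\mathbf{F}_E$ and $J_E$ the absolute value of its determinant. Spaces: $$\mathcal{DS}_{r+1}^{\mathrm{map}}(E)=\mathbb{P}_{r+1}(E)\oplus\mathrm{span}\big\{F_E^0\big((1-\hat x_2^2)\hat x_1\hat x_2^{r-1}\big),F_E^0\big((1-\hat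 x_1^2)\hat x_2\hat x_1^{r-1}\big)\big\},$$ $$\mathbb{S}_r^{\mathrm{AC}}(E)=\mathrm{span}\big\{\mathbf{F}_E^1\,\mathrm{curl}\big((1-\hat x_2^2)\hat x_1\hat x_2^{r-1}\big),\mathbf{F}_E^1\,\mathrm{curl}\big((1-\hat x_1^2)\hat x_2\hat x_1^{r-1}\big)\big\}$$ (here $\mathrm{curl}$ is taken with respect to $\hat{\mathbf{x}}$), $$\mathrm{AC}_r^{\mathrm{red}}(E)=\mathbb{P}_r^2(E)\oplus\mathbb{S}_r^{\mathrm{AC}}(E),\qquad \mathrm{AC}_r(E)=\mathrm{AC}_r^{\mathrm{red}}(E)\oplus\mathbf{x}\tilde{\mathbb{P}}_r(E).$$ *)

theory Defs
  imports "HOL-Analysis.Analysis"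
begin

section \<open>Quadrilaterals and the bilinear map\<close>

text \<open>
  The set \<open>E\<close> is a quadrilateral with vertices \<open>a, b, c, d\<close> listed consecutively, in either
  orientation.  Requiring four distinct extreme points excludes the degenerate cases.
\<close>

definition convex_quadrilateral ::
  "real^2 \<Rightarrow> real^2 \<Rightarrow> real^2 \<Rightarrow> real^2 \<Rightarrow> (real^2) set \<Rightarrow> bool" where
  "convex_quadrilateral a b c d E \<longleftrightarrow>
     E = convex hull {a, b, c, d} \<and>
     distinct [a, b, c, d] \<and>
     {x. x extreme_point_of E} = {a, b, c, d} \<and>
     closed_segment a b edge_of E \<and> closed_segment b c edge_of E \<and>
     closed_segment c d edge_of E \<and> closed_segment d a edge_of E"

definition ref_square :: "(real^2) set" where
  "ref_square = {y. \<bar>y$1\<bar> \<le> 1 \<and> \<bar>y$2\<bar> \<le> 1}"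

text \<open>
  The vertices \<open>(-1,-1), (1,-1), (1,1), (-1,1)\<close> of the reference square go to \<open>a, b, c, d\<close>.
\<close>

definition bilin_map :: "real^2 \<Rightarrow> real^2 \<Rightarrow> real^2 \<Rightarrow> real^2 \<Rightarrow> real^2 \<Rightarrow> real^2" where
  "bilin_map a b c d y =
     ((1 - y$1) * (1 - y$2) / 4) *\<^sub>R a + ((1 + y$1) * (1 - y$2) / 4) *\<^sub>R b +
     ((1 + y$1) * (1 + y$2) / 4) *\<^sub>R c + ((1 - y$1) * (1 + y$2) / 4) *\<^sub>R d"

section \<open>Functions on a set\<close>

text \<open>
  A function on \<open>E\<close> is represented by the total function that agrees with it on \<open>E\<close> and vanishes
  elsewhere, so that equality of representatives is equality on \<open>E\<close>.
\<close>

definition on_set :: "(real^2) set \<Rightarrow> (real^2 \<Rightarrow> 'v) \<Rightarrow> real^2 \<Rightarrow> 'v::real_vector" where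
  "on_set E f = (\<lambda>x. if x \<in> E then f x else 0)"

definition fun_span2 :: "(real^2 \<Rightarrow> 'v) \<Rightarrow> (real^2 \<Rightarrow> 'v) \<Rightarrow> (real^2 \<Rightarrow> 'v::real_vector) set" where
  "fun_span2 f g = {(\<lambda>x. \<alpha> *\<^sub>R f x + \<beta> *\<^sub>R g x) |\<alpha> \<beta>. True}"

definition fun_sum ::
  "(real^2 \<Rightarrow> 'v) set \<Rightarrow> (real^2 \<Rightarrow> 'v) set \<Rightarrow> (real^2 \<Rightarrow> 'v::real_vector) set" where
  "fun_sum V W = {(\<lambda>x. f x + g x) |f g. f \<in> V \<and> g \<in> W}"

definition sum_is_direct ::
  "(real^2 \<Rightarrow> 'v) set \<Rightarrow> (real^2 \<Rightarrow> 'v::real_vector) set \<Rightarrow> bool" where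
  "sum_is_direct V W \<longleftrightarrow> V \<inter> W = {\<lambda>x. 0}"

section \<open>Differential operators\<close>

text \<open>
  The derivative is taken within \<open>E\<close>.  For convex \<open>E\<close> with nonempty interior it is unique at every
  point of \<open>E\<close>, boundary and corners included, where it extends the interior partial derivatives
  of a function that is smooth up to the boundary.
\<close>

definition partial_on :: "(real^2) set \<Rightarrow> 2 \<Rightarrow> (real^2 \<Rightarrow> real) \<Rightarrow> real^2 \<Rightarrow> real" where
  "partial_on E i \<phi> x = frechet_derivative \<phi> (at x within E) (axis i 1)"

definition curl_on :: "(real^2) set \<Rightarrow> (real^2 \<Rightarrow> real) \<Rightarrow> real^2 \<Rightarrow> real^2" where
  "curl_on E \<phi> = on_set E (\<lambda>x. vector [partial_on E 2 \<phi> x, - partial_on E 1 \<phi> x])"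

definition div_on :: "(real^2) set \<Rightarrow> (real^2 \<Rightarrow> real^2) \<Rightarrow> real^2 \<Rightarrow> real" where
  "div_on E \<psi> =
     on_set E (\<lambda>x. partial_on E 1 (\<lambda>z. \<psi> z $ 1) x + partial_on E 2 (\<lambda>z. \<psi> z $ 2) x)"

section \<open>Polynomial spaces\<close>

definition poly_space :: "nat \<Rightarrow> (real^2) set \<Rightarrow> (real^2 \<Rightarrow> real) set" where
  "poly_space k E =
     {on_set E (\<lambda>x. \<Sum>i\<le>k. \<Sum>j\<le>k - i. c i j * (x$1) ^ i * (x$2) ^ j) |c. True}"

definition vec_poly_space :: "nat \<Rightarrow> (real^2) set \<Rightarrow> (real^2 \<Rightarrow> real^2) set" where
  "vec_poly_space k E =
     {\<psi>. (\<lambda>x. \<psi> x $ 1) \<in> poly_space k E \<and> (\<lambda>x. \<psi> x $ 2) \<in> poly_space k E}"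

definition hom_poly_space :: "nat \<Rightarrow> (real^2) set \<Rightarrow> (real^2 \<Rightarrow> real) set" where
  "hom_poly_space k E =
     {on_set E (\<lambda>x. \<Sum>i\<le>k. c i * (x$1) ^ i * (x$2) ^ (k - i)) |c. True}"

definition position_times :: "(real^2 \<Rightarrow> real) set \<Rightarrow> (real^2 \<Rightarrow> real^2) set" where
  "position_times V = {(\<lambda>x. q x *\<^sub>R x) |q. q \<in> V}"

section \<open>Mapped spaces\<close>

text \<open>\<open>F\<close> stands for the bilinear bijection from the reference square onto \<open>E\<close>.\<close>

definition pull0 :: "(real^2 \<Rightarrow> real^2) \<Rightarrow> (real^2) set \<Rightarrow> (real^2 \<Rightarrow> real) \<Rightarrow> real^2 \<Rightarrow> real" where
  "pull0 F E \<phi> = on_set E (\<lambda>x. \<phi> (inv_into ref_square F x))"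

definition piola :: "(real^2 \<Rightarrow> real^2) \<Rightarrow> (real^2) set \<Rightarrow> (real^2 \<Rightarrow> real^2) \<Rightarrow> real^2 \<Rightarrow> real^2" where
  "piola F E \<psi> = on_set E (\<lambda>x.
     let y = inv_into ref_square F x; DF = jacobian F (at y)
     in (1 / \<bar>det DF\<bar>) *\<^sub>R (DF *v \<psi> y))"

definition suppl1 :: "nat \<Rightarrow> real^2 \<Rightarrow> real" where
  "suppl1 r y = (1 - (y$2)\<^sup>2) * y$1 * (y$2) ^ (r - 1)"

definition suppl2 :: "nat \<Rightarrow> real^2 \<Rightarrow> real" where
  "suppl2 r y = (1 - (y$1)\<^sup>2) * y$2 * (y$1) ^ (r - 1)"

definition DS_suppl :: "nat \<Rightarrow> (real^2 \<Rightarrow> real^2) \<Rightarrow> (real^2) set \<Rightarrow> (real^2 \<Rightarrow> real) set" where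
  "DS_suppl r F E = fun_span2 (pull0 F E (suppl1 r)) (pull0 F E (suppl2 r))"

text \<open>\<open>DS_map r\<close> is the mapped direct serendipity space of index \<open>r + 1\<close>.\<close>

definition DS_map :: "nat \<Rightarrow> (real^2 \<Rightarrow> real^2) \<Rightarrow> (real^2) set \<Rightarrow> (real^2 \<Rightarrow> real) set" where
  "DS_map r F E = fun_sum (poly_space (r + 1) E) (DS_suppl r F E)"

definition AC_suppl :: "nat \<Rightarrow> (real^2 \<Rightarrow> real^2) \<Rightarrow> (real^2) set \<Rightarrow> (real^2 \<Rightarrow> real^2) set" where
  "AC_suppl r F E =
     fun_span2 (piola F E (curl_on ref_square (suppl1 r))) (piola F E (curl_on ref_square (suppl2 r)))"

definition AC_red :: "nat \<Rightarrow> (real^2 \<Rightarrow> real^2) \<Rightarrow> (real^2) set \<Rightarrow> (real^2 \<Rightarrow> real^2) set" where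
  "AC_red r F E = fun_sum (vec_poly_space r E) (AC_suppl r F E)"

definition AC_full :: "nat \<Rightarrow> (real^2 \<Rightarrow> real^2) \<Rightarrow> (real^2) set \<Rightarrow> (real^2 \<Rightarrow> real^2) set" where
  "AC_full r F E = fun_sum (AC_red r F E) (position_times (hom_poly_space r E))"

section \<open>Exactness\<close>

definition const_on :: "(real^2) set \<Rightarrow> real \<Rightarrow> real^2 \<Rightarrow> real" where
  "const_on E t = on_set E (\<lambda>x. t)"

text \<open>
  Well-definedness and exactness of the sequence from the constants through \<open>V\<close> (by the inclusion),
  \<open>W\<close> (by the curl) and \<open>Q\<close> (by the divergence) to zero.  Differentiability is part of
  well-definedness because \<^const>\<open>frechet_derivative\<close> is total.
\<close>

definition exact_curl_div ::
  "(real^2) set \<Rightarrow> (real^2 \<Rightarrow> real) set \<Rightarrow> (real^2 \<Rightarrow> real^2) set \<Rightarrow> (real^2 \<Rightarrow> real) set \<Rightarrow> bool" where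
  "exact_curl_div E V W Q \<longleftrightarrow>
     (\<forall>\<phi>\<in>V. \<phi> differentiable_on E) \<and> (\<forall>\<psi>\<in>W. \<psi> differentiable_on E) \<and>
     range (const_on E) \<subseteq> V \<and> curl_on E ` V \<subseteq> W \<and> div_on E ` W \<subseteq> Q \<and>
     inj (const_on E) \<and>
     range (const_on E) = {\<phi> \<in> V. curl_on E \<phi> = (\<lambda>x. 0)} \<and>
     curl_on E ` V = {\<psi> \<in> W. div_on E \<psi> = (\<lambda>x. 0)} \<and>
     div_on E ` W = Q"

end

theory Submission
  imports Defs
begin

text \<open>
  The proof separates polynomials, where everything is classical, from the two supplements, whose
  contribution to the sequences is trivial.  The Piola map commutes with the curl up to the sign
  \<open>\<sigma>\<close> of the Jacobian determinant (\<open>curl_pull0\<close>, \<open>piola_curl\<close>), so the supplement of the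
  Arbogast-Correa spaces is exactly the curl of the serendipity supplement (\<open>AC_suppl_eq\<close>).  The
  fields in it are divergence free (\<open>flux_divergence_free\<close>).  Hence the supplements are matched by
  the curl and disappear under the divergence, and exactness reduces to the polynomial parts
  (\<open>exact_curl_div_polynomial_part\<close>): a divergence-free polynomial field is the curl of a polynomial
  of one degree more (\<open>polyn_curl_potential\<close>), polynomials have polynomial antiderivatives, and
  Euler's identity \<open>div (x h) = (r + 2) h\<close> for homogeneous \<open>h\<close> of degree \<open>r\<close> shows that the summand
  \<open>x h\<close> adds precisely the missing top degree to the divergence and nothing to its kernel.

  The point that needs an argument special to these spaces is that no nonzero combination \<open>\<Phi>\<close> of the
  two supplements is a polynomial of degree \<open>r + 1\<close> on \<open>E\<close> (\<open>bubble_not_polyn\<close>).  If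
  \<open>p \<circ> F = \<Phi>\<close> on the square, then this identity of polynomials holds on the whole plane.  When \<open>F\<close> is
  not affine it is not injective there: in the coordinates of \<open>E\<close> given by the midlines it has the form
  \<open>(u + l u v, v + m u v)\<close>, and if \<open>l \<noteq> 0\<close>, the line \<open>v = - 1 / l\<close> is mapped into the
  image of the axis \<open>u = 0\<close>.  Points with the same image need equal values of \<open>\<Phi>\<close>, which fails unless \<open>\<Phi> = 0\<close>
  because \<open>\<bar>l\<bar> < 1\<close>.  When \<open>F\<close> is affine, \<open>\<Phi>\<close> has degree \<open>r + 2\<close>, which is too large.  The
  directness of the other two sums follows from this and from a comparison of divergences.

  Analytically, everything rests on the inverse \<open>G\<close> of \<open>F\<close> being differentiable up to the boundary of
  \<open>E\<close> (\<open>G_has_derivative\<close>), because \<open>F\<close> is injective on an open half-plane containing the square.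
  The geometric input is that the determinant has one sign on the square and that \<open>F\<close> maps the
  square onto \<open>E\<close> (\<open>convex_quadrilateral_chart\<close>).
\<close>

section \<open>Curl and divergence on a convex set\<close>

text \<open>
  A coordinate direction need not point into the set at a corner, so uniqueness is tested along the
  chords from \<open>x\<close> to the other points of \<open>S\<close>; these directions span the space since \<open>S\<close> has interior
  points.
\<close>

lemma has_derivative_within_convex_unique:
  fixes f :: "'a::euclidean_space \<Rightarrow> 'b::real_normed_vector"
  assumes S: "convex S" "interior S \<noteq> {}" and x: "x \<in> S"
    and f': "(f has_derivative f') (at x within S)"
    and f'': "(f has_derivative f'') (at x within S)"
  shows "f' = f''"
proof -
  define L where "L = (\<lambda>h. f' h - f'' h)"
  have L: "((\<lambda>z. 0::'b) has_derivative L) (at x within S)"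
    using has_derivative_diff[OF f' f''] by (simp add: L_def)
  interpret L: bounded_linear L using has_derivative_bounded_linear[OF L] .
  have on_chords: "L (y - x) = 0" if y: "y \<in> S" for y
  proof -
    have into_S: "(\<lambda>t::real. x + t *\<^sub>R (y - x)) ` {0..1} \<subseteq> S"
      using convexD_alt[OF S(1) x y] by (auto simp: algebra_simps)
    have "((\<lambda>t::real. x + t *\<^sub>R (y - x)) has_derivative (\<lambda>t. t *\<^sub>R (y - x))) (at 0 within {0..1})"
      by (auto intro!: derivative_eq_intros)
    from has_derivative_in_compose[OF this has_derivative_subset[OF _ into_S, of "\<lambda>z. 0::'b" L]] L
    have "((\<lambda>t::real. 0::'b) has_derivative (\<lambda>t. L (t *\<^sub>R (y - x)))) (at 0 within {0..1})"
      by simp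
    moreover have "((\<lambda>t::real. 0::'b) has_derivative (\<lambda>t. 0)) (at 0 within {0..1})" by simp
    ultimately have "(\<lambda>t. L (t *\<^sub>R (y - x))) = (\<lambda>t. 0)"
    proof (rule frechet_derivative_unique_within)
      fix i e :: real assume "i \<in> Basis" "e > 0"
      then show "\<exists>d. 0 < \<bar>d\<bar> \<and> \<bar>d\<bar> < e \<and> 0 + d *\<^sub>R i \<in> {0..1}"
        by (intro exI[of _ "min (e/2) 1"]) auto
    qed
    from fun_cong[OF this, of 1] show ?thesis by simp
  qed
  from S(2) obtain z e where e: "e > 0" "ball z e \<subseteq> S"
    using mem_interior by blast
  have "L v = 0" for v
  proof (cases "v = 0")
    case False
    define w where "w = (e / 2 / norm v) *\<^sub>R v"
    have "z + w \<in> S" "z \<in> S"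
      using e False by (auto simp: w_def dist_norm intro!: subsetD[OF e(2)])
    from on_chords[OF this(1)] on_chords[OF this(2)] have "L w = 0"
      by (simp add: L.diff L.add)
    then show ?thesis using False e by (simp add: w_def L.scaleR)
  qed (simp add: L.zero)
  then show ?thesis by (auto simp: L_def fun_eq_iff)
qed

lemma has_derivative_on_set:
  assumes "(f has_derivative f') (at x within E)" "x \<in> E"
  shows "(on_set E f has_derivative f') (at x within E)"
  by (rule has_derivative_transform_within[OF assms(1) zero_less_one assms(2)]) (auto simp: on_set_def)

lemma partial_on_eqI:
  assumes "convex E" "interior E \<noteq> {}" "x \<in> E" "(f has_derivative f') (at x within E)"
  shows "partial_on E i f x = f' (axis i 1)"
proof -
  have "(f has_derivative frechet_derivative f (at x within E)) (at x within E)"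
    using assms(4) by (metis differentiableI frechet_derivative_works)
  from has_derivative_within_convex_unique[OF assms(1-3) this assms(4)]
  show ?thesis by (simp add: partial_on_def)
qed

lemma partial_on_UNIV_eqI:
  assumes "(f has_derivative f') (at x)"
  shows "partial_on UNIV i f x = f' (axis i 1)"
  using partial_on_eqI[of UNIV x f f' i] assms by simp

lemma on_set_cong: "(\<And>x. x \<in> E \<Longrightarrow> f x = g x) \<Longrightarrow> on_set E f = on_set E g"
  by (auto simp: on_set_def)

lemma on_set_eq_iff: "on_set E f = on_set E g \<longleftrightarrow> (\<forall>x\<in>E. f x = g x)"
  by (auto simp: on_set_def fun_eq_iff)

lemma on_set_apply: "x \<in> E \<Longrightarrow> on_set E f x = f x"
  by (simp add: on_set_def)

lemma vector_2_eq_iff: "(v::real^2) = w \<longleftrightarrow> v$1 = w$1 \<and> v$2 = w$2"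
  by (simp add: vec_eq_iff forall_2)

text \<open>
  The derivative is tied to functions for both partial derivatives at once, so that sums, products and
  compositions can be differentiated without unfolding \<open>frechet_derivative\<close>.
\<close>

definition has_partials :: "(real^2) set \<Rightarrow> (real^2 \<Rightarrow> real) \<Rightarrow> (real^2 \<Rightarrow> real) \<Rightarrow> (real^2 \<Rightarrow> real) \<Rightarrow> bool" where
  "has_partials E f f1 f2 \<longleftrightarrow> 
    (\<forall>x\<in>E. (f has_derivative (\<lambda>h. h$1 * f1 x + h$2 * f2 x)) (at x within E))"

lemma has_partials_add:
  assumes "has_partials E f f1 f2" "has_partials E g g1 g2"
  shows "has_partials E (\<lambda>x. f x + g x) (\<lambda>x. f1 x + g1 x) (\<lambda>x. f2 x + g2 x)"
  unfolding has_partials_def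
proof
  fix x assume x: "x \<in> E"
  from has_derivative_add[OF assms[unfolded has_partials_def, THEN bspec, OF x]]
  show "((\<lambda>x. f x + g x) has_derivative (\<lambda>h. h$1 * (f1 x + g1 x) + h$2 * (f2 x + g2 x))) (at x within E)"
    by (simp add: algebra_simps)
qed

lemma has_partials_on_set: 
  "has_partials E f f1 f2 \<Longrightarrow> has_partials E (on_set E f) f1 f2"
  by (auto simp: has_partials_def intro: has_derivative_on_set)

lemma has_partials_differentiable_on: "has_partials E f f1 f2 \<Longrightarrow> f differentiable_on E"
  by (auto simp: has_partials_def differentiable_on_def differentiable_def)

lemma vec2_differentiable_on:
  fixes \<psi> :: "real^2 \<Rightarrow> real^2"
  assumes "has_partials E (\<lambda>x. \<psi> x $ 1) p1 p2" "has_partials E (\<lambda>x. \<psi> x $ 2) q1 q2"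
  shows "\<psi> differentiable_on E"
proof -
  have "(\<lambda>x. \<psi> x \<bullet> b) differentiable (at x within E)" if "x \<in> E" "b \<in> Basis" for x b
  proof -
    obtain i where "b = axis i 1" using \<open>b \<in> Basis\<close> by (auto simp: Basis_vec_def)
    then show ?thesis
      using exhaust_2[of i] assms[THEN has_partials_differentiable_on] \<open>x \<in> E\<close>
      by (auto simp: inner_axis differentiable_on_def)
  qed
  then show ?thesis unfolding differentiable_on_def
    using differentiable_componentwise_within by blast
qed

locale convex_body =
  fixes E :: "(real^2) set"
  assumes convex: "convex E" and interior: "interior E \<noteq> {}"
begin

lemma nonempty: "E \<noteq> {}"
  using interior by auto

lemma partial_on_eq:
  assumes "has_partials E f f1 f2" "x \<in> E"
  shows "partial_on E 1 f x = f1 x" "partial_on E 2 f x = f2 x"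
  using partial_on_eqI[OF convex interior assms(2) assms(1)[unfolded has_partials_def, THEN bspec, OF assms(2)]]
  by (simp_all add: axis_def)

lemma curl_on_eq:
  assumes "has_partials E f f1 f2"
  shows "curl_on E f = on_set E (\<lambda>x. vector [f2 x, - f1 x])"
  unfolding curl_on_def using partial_on_eq[OF assms] by (auto intro!: on_set_cong)

lemma div_on_eq:
  assumes "has_partials E (\<lambda>x. \<psi> x $ 1) p1 p2" "has_partials E (\<lambda>x. \<psi> x $ 2) q1 q2"
  shows "div_on E \<psi> = on_set E (\<lambda>x. p1 x + q2 x)"
  unfolding div_on_def using partial_on_eq[OF assms(1)] partial_on_eq[OF assms(2)]
  by (auto intro!: on_set_cong)

lemma curl_const: "curl_on E (const_on E t) = (\<lambda>x. 0)"
proof -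
  have "has_partials E (const_on E t) (\<lambda>x. 0) (\<lambda>x. 0)"
    unfolding const_on_def by (rule has_partials_on_set) (simp add: has_partials_def)
  from curl_on_eq[OF this] show ?thesis
    by (simp add: fun_eq_iff on_set_def vector_2_eq_iff)
qed

lemma curl_zero: "curl_on E (\<lambda>x. 0) = (\<lambda>x. 0)"
  using curl_const[of 0] by (simp add: const_on_def on_set_def)

lemma equal_curl_differ_by_constant:
  assumes f: "has_partials E f f1 f2" and g: "has_partials E g g1 g2" and "curl_on E f = curl_on E g"
  obtains c where "\<And>x. x \<in> E \<Longrightarrow> f x = g x + c"
proof -
  have eq: "f1 x = g1 x" "f2 x = g2 x" if "x \<in> E" for x
    using fun_cong[OF assms(3), of x] that
    by (auto simp: curl_on_eq[OF f] curl_on_eq[OF g] on_set_def vector_2_eq_iff)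
  have "((\<lambda>x. f x - g x) has_derivative (\<lambda>h. 0)) (at x within E)" if "x \<in> E" for x
    using has_derivative_diff[OF f[unfolded has_partials_def, THEN bspec, OF that]
        g[unfolded has_partials_def, THEN bspec, OF that]] eq[OF that] by simp
  from has_derivative_zero_constant[OF convex this]
  obtain c where "\<forall>x\<in>E. f x - g x = c" by blast
  then show thesis by (intro that[of c]) (auto simp: algebra_simps)
qed

end

section \<open>Polynomials in two variables\<close>

definition polyn :: "nat \<Rightarrow> (real^2 \<Rightarrow> real) set" where
  "polyn k = {(\<lambda>x. \<Sum>i\<le>k. \<Sum>j\<le>k - i. c i j * (x$1) ^ i * (x$2) ^ j) |c. True}"

lemma poly_space_eq: "poly_space k E = on_set E ` polyn k"
  by (auto simp: poly_space_def polyn_def)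

lemma polyn_add: 
  assumes "f \<in> polyn k" "g \<in> polyn k" shows "(\<lambda>x. f x + g x) \<in> polyn k"
proof -
  obtain c d where "f = (\<lambda>x. \<Sum>i\<le>k. \<Sum>j\<le>k - i. c i j * (x$1) ^ i * (x$2) ^ j)"
    "g = (\<lambda>x. \<Sum>i\<le>k. \<Sum>j\<le>k - i. d i j * (x$1) ^ i * (x$2) ^ j)"
    using assms by (auto simp: polyn_def)
  then show ?thesis unfolding polyn_def
    by (auto simp: sum.distrib algebra_simps intro!: exI[of _ "\<lambda>i j. c i j + d i j"])
qed

lemma polyn_cmul: 
  assumes "f \<in> polyn k" shows "(\<lambda>x. s * f x) \<in> polyn k"
proof -
  obtain c where "f = (\<lambda>x. \<Sum>i\<le>k. \<Sum>j\<le>k - i. c i j * (x$1) ^ i * (x$2) ^ j)"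
    using assms by (auto simp: polyn_def)
  then show ?thesis unfolding polyn_def
    by (auto simp: sum_distrib_left algebra_simps intro!: exI[of _ "\<lambda>i j. s * c i j"])
qed

lemma polyn_minus: "f \<in> polyn k \<Longrightarrow> (\<lambda>x. - f x) \<in> polyn k"
  using polyn_cmul[of f k "-1"] by simp

lemma polyn_monom:
  assumes "i + j \<le> k" shows "(\<lambda>x. c * (x$1)^i * (x$2)^j) \<in> polyn k"
proof -
  let ?c = "\<lambda>i' j'. if i' = i then if j' = j then c else 0 else 0"
  have "c * (x$1)^i * (x$2)^j = (\<Sum>i'\<le>k. \<Sum>j'\<le>k - i'. ?c i' j' * (x$1) ^ i' * (x$2) ^ j')" 
    for x :: "real^2"
  proof -
    have "(\<Sum>i'\<le>k. \<Sum>j'\<le>k - i'. ?c i' j' * (x$1) ^ i' * (x$2) ^ j') =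
      (\<Sum>i'\<le>k. if i' = i then (\<Sum>j'\<le>k - i'. if j' = j then c * (x$1) ^ i * (x$2) ^ j else 0) else 0)"
      by (intro sum.cong refl) (auto intro!: sum.cong simp del: sum.delta sum.delta')
    also have "\<dots> = c * (x$1)^i * (x$2)^j" using assms by simp
    finally show ?thesis by (rule sym)
  qed
  then have "(\<lambda>x::real^2. c * (x$1)^i * (x$2)^j) =
      (\<lambda>x. \<Sum>i'\<le>k. \<Sum>j'\<le>k - i'. ?c i' j' * (x$1) ^ i' * (x$2) ^ j')" by (rule ext)
  then show ?thesis unfolding polyn_def by (intro CollectI exI[of _ ?c]) simp
qed

lemma polyn_const: "(\<lambda>x. c) \<in> polyn k"
  using polyn_monom[of 0 0 k c] by simp

lemma polyn_sum: "finite I \<Longrightarrow> (\<And>i. i \<in> I \<Longrightarrow> f i \<in> polyn k) \<Longrightarrow> (\<lambda>x. \<Sum>i\<in>I. f i x) \<in> polyn k"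
  by (induction I rule: finite_induct) (auto intro: polyn_const polyn_add)

lemma polyn_induct [consumes 1, case_names zero add monom]:
  assumes "f \<in> polyn k"
    and zero: "P (\<lambda>x. 0)"
    and add: "\<And>f g. f \<in> polyn k \<Longrightarrow> g \<in> polyn k \<Longrightarrow> P f \<Longrightarrow> P g \<Longrightarrow> P (\<lambda>x. f x + g x)"
    and monom: "\<And>c i j. i + j \<le> k \<Longrightarrow> P (\<lambda>x. c * (x$1)^i * (x$2)^j)"
  shows "P f"
proof -
  have sum: "(\<lambda>x. \<Sum>i\<in>I. g i x) \<in> polyn k \<and> P (\<lambda>x. \<Sum>i\<in>I. g i x)"
    if "finite I" "\<And>i. i \<in> I \<Longrightarrow> g i \<in> polyn k \<and> P (g i)" for I and g :: "nat \<Rightarrow> real^2 \<Rightarrow> real"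
    using that by (induction I rule: finite_induct) (auto intro: zero add polyn_const polyn_add)
  obtain c where "f = (\<lambda>x. \<Sum>i\<le>k. \<Sum>j\<le>k - i. c i j * (x$1) ^ i * (x$2) ^ j)"
    using assms(1) by (auto simp: polyn_def)
  then show ?thesis
    by (auto intro!: sum[THEN conjunct2] sum polyn_monom monom)
qed

lemma polyn_mono: "f \<in> polyn k \<Longrightarrow> k \<le> l \<Longrightarrow> f \<in> polyn l"
  by (induction rule: polyn_induct) (auto intro: polyn_const polyn_add polyn_monom)

abbreviation pd :: "2 \<Rightarrow> (real^2 \<Rightarrow> real) \<Rightarrow> real^2 \<Rightarrow> real" where
  "pd \<equiv> partial_on UNIV"

lemmas has_derivative_vec_nth [derivative_intros] =
  bounded_linear.has_derivative[OF bounded_linear_vec_nth]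

lemma monom_has_derivative:
  "((\<lambda>x::real^2. c * (x$1)^i * (x$2)^j) has_derivative
     (\<lambda>h. h$1 * (c * real i * (x$1)^(i-1) * (x$2)^j) + h$2 * (c * real j * (x$1)^i * (x$2)^(j-1)))) (at x)"
  by (auto intro!: derivative_eq_intros simp: fun_eq_iff algebra_simps)

lemma pd_eqI:
  assumes "\<And>x. (f has_derivative (\<lambda>h. h$1 * f1 x + h$2 * f2 x)) (at x)"
  shows "pd 1 f = f1" "pd 2 f = f2"
  using partial_on_UNIV_eqI[OF assms] by (auto simp: axis_def fun_eq_iff)

lemmas pd_monom = pd_eqI[OF monom_has_derivative]

lemma polyn_has_derivative:
  assumes "f \<in> polyn k"
  shows "(f has_derivative (\<lambda>h. h$1 * pd 1 f x + h$2 * pd 2 f x)) (at x)"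
proof -
  have "\<exists>f1 f2. \<forall>x. (f has_derivative (\<lambda>h. h$1 * f1 x + h$2 * f2 x)) (at x)"
    using assms
  proof (induction rule: polyn_induct)
    case zero
    then show ?case by (intro exI[of _ "\<lambda>x. 0"]) auto
  next
    case (add f g)
    then obtain f1 f2 g1 g2 where "\<And>x. (f has_derivative (\<lambda>h. h$1 * f1 x + h$2 * f2 x)) (at x)"
      "\<And>x. (g has_derivative (\<lambda>h. h$1 * g1 x + h$2 * g2 x)) (at x)" by blast
    from has_derivative_add[OF this] show ?case
      by (intro exI[of _ "\<lambda>x. f1 x + g1 x"] exI[of _ "\<lambda>x. f2 x + g2 x"]) (simp add: algebra_simps)
  next
    case (monom c i j)
    show ?case using monom_has_derivative[of c i j]
      by (intro exI[of _ "\<lambda>x. c * real i * (x$1)^(i-1) * (x$2)^j"]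
          exI[of _ "\<lambda>x. c * real j * (x$1)^i * (x$2)^(j-1)"]) auto
  qed
  then obtain f1 f2 where f: "\<And>x. (f has_derivative (\<lambda>h. h$1 * f1 x + h$2 * f2 x)) (at x)" by blast
  show ?thesis using f[of x] unfolding pd_eqI[OF f] .
qed

lemma pd_add:
  assumes "f \<in> polyn k" "g \<in> polyn l"
  shows "pd i (\<lambda>x. f x + g x) = (\<lambda>x. pd i f x + pd i g x)"
proof 
  fix x
  have i: "i = 1 \<or> i = 2" by (rule exhaust_2)
  from has_derivative_add[OF polyn_has_derivative[OF assms(1)] polyn_has_derivative[OF assms(2)]]
  have "((\<lambda>x. f x + g x) has_derivative (\<lambda>h. h$1 * pd 1 f x + h$2 * pd 2 f x + (h$1 * pd 1 g x + h$2 * pd 2 g x))) (at x)" .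
  from partial_on_UNIV_eqI[OF this, of i] i
  show "pd i (\<lambda>x. f x + g x) x = pd i f x + pd i g x" by (auto simp: axis_def)
qed

lemma pd_cmul:
  assumes "f \<in> polyn k"
  shows "pd i (\<lambda>x. c * f x) = (\<lambda>x. c * pd i f x)"
proof 
  fix x
  have i: "i = 1 \<or> i = 2" by (rule exhaust_2)
  have "((\<lambda>x. c * f x) has_derivative (\<lambda>h. c * (h$1 * pd 1 f x + h$2 * pd 2 f x))) (at x)"
    by (rule has_derivative_mult_right[OF polyn_has_derivative[OF assms(1)]])
  from partial_on_UNIV_eqI[OF this, of i] i
  show "pd i (\<lambda>x. c * f x) x = c * pd i f x" by (auto simp: axis_def)
qed

lemma polyn_pd: "f \<in> polyn k \<Longrightarrow> pd i f \<in> polyn (k - 1)"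
proof (induction rule: polyn_induct)
  case zero
  have "pd i (\<lambda>x. 0) = (\<lambda>x. 0)"
    using partial_on_UNIV_eqI[of "\<lambda>x. 0" "\<lambda>x. 0"] by auto
  then show ?case by (simp add: polyn_const)
next
  case (add f g)
  then show ?case by (simp add: pd_add polyn_add)
next
  case (monom c i' j)
  have *: "(\<lambda>x. c * real i' * (x$1)^(i'-1) * (x$2)^j) \<in> polyn (k - 1)"
    using polyn_monom[of "i'-1" j "k - 1" "c * real i'"] polyn_const[of 0 "k-1"] monom
    by (cases i') auto
  have **: "(\<lambda>x. c * real j * (x$1)^i' * (x$2)^(j-1)) \<in> polyn (k - 1)"
    using polyn_monom[of i' "j-1" "k - 1" "c * real j"] polyn_const[of 0 "k-1"] monom
    by (cases j) auto
  show ?case using exhaust_2[of i] * ** by (auto simp: pd_monom)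
qed

lemma pd_commute: "f \<in> polyn k \<Longrightarrow> pd 1 (pd 2 f) = pd 2 (pd 1 f)"
proof (induction rule: polyn_induct)
  case zero
  show ?case using pd_monom[of 0 0 0] by simp
next
  case (add f g)
  then show ?case by (simp add: pd_add[OF add(1,2)] pd_add[OF polyn_pd[OF add(1)] polyn_pd[OF add(2)]])
next
  case (monom c i j)
  show ?case by (simp only: pd_monom) (simp add: fun_eq_iff)
qed

lemma polyn_antiderivative:
  assumes "f \<in> polyn k" shows "\<exists>g \<in> polyn (Suc k). pd i g = f"
  using assms
proof (induction rule: polyn_induct)
  case zero
  show ?case using pd_monom[of 0 0 0] exhaust_2[of i] by (intro bexI[of _ "\<lambda>x. 0"]) (auto intro: polyn_const)
next
  case (add f g)
  then obtain F G where "F \<in> polyn (Suc k)" "pd i F = f" "G \<in> polyn (Suc k)" "pd i G = g" by blast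
  then show ?case by (intro bexI[of _ "\<lambda>x. F x + G x"]) (simp_all add: pd_add polyn_add)
next
  case (monom c i' j)
  let ?f = "\<lambda>x::real^2. c * (x$1)^i' * (x$2)^j"
  let ?g1 = "\<lambda>x::real^2. c / real (Suc i') * (x$1)^Suc i' * (x$2)^j"
  let ?g2 = "\<lambda>x::real^2. c / real (Suc j) * (x$1)^i' * (x$2)^Suc j"
  have "?g1 \<in> polyn (Suc k)" "?g2 \<in> polyn (Suc k)"
    by (rule polyn_monom; use monom in simp)+
  moreover have "pd 1 ?g1 = ?f" "pd 2 ?g2 = ?f"
    by (simp_all only: pd_monom) (simp_all add: fun_eq_iff)
  moreover have "i = 1 \<or> i = 2" by (rule exhaust_2)
  ultimately show ?case by blast
qed

text \<open>
  A polynomial that does not depend on the second variable equals its restriction to the first axis,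
  so integrating in the first variable keeps it independent of the second.
\<close>

lemma polyn_antiderivative_fst:
  assumes "f \<in> polyn k" "pd 2 f = (\<lambda>x. 0)"
  shows "\<exists>g \<in> polyn (Suc k). pd 1 g = f \<and> pd 2 g = (\<lambda>x. 0)"
proof -
  obtain c where c: "f = (\<lambda>x. \<Sum>i\<le>k. \<Sum>j\<le>k - i. c i j * (x$1) ^ i * (x$2) ^ j)"
    using assms(1) by (auto simp: polyn_def)
  have "f x = f (vector [x$1, 0])" for x
  proof -
    define y :: "real^2" where "y = vector [x$1, 0]"
    let ?h = "\<lambda>t. f (y + t *\<^sub>R axis 2 1)"
    have "((\<lambda>t. y + t *\<^sub>R axis 2 1) has_derivative (\<lambda>t. t *\<^sub>R axis 2 1)) (at t)" for t
      by (auto intro!: derivative_eq_intros)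
    from has_derivative_compose[OF this polyn_has_derivative[OF assms(1)]]
    have "(?h has_derivative (\<lambda>t. 0)) (at t)" for t
      by (simp add: assms(2) axis_def)
    then obtain C where "\<And>t. ?h t = C"
      using has_derivative_zero_constant[of UNIV ?h] by auto
    from this[of "x$2"] this[of 0] have "?h (x$2) = ?h 0" by simp
    moreover have "y + (x$2) *\<^sub>R axis 2 1 = x"
      by (simp add: y_def vec_eq_iff forall_2 axis_def)
    ultimately show ?thesis by (simp add: y_def)
  qed
  also have "f (vector [x$1, 0]) = (\<Sum>i\<le>k. c i 0 * x$1 ^ i)" for x :: "real^2"
    unfolding c by (intro sum.cong refl) (auto simp: power_0_left if_distrib cong: if_cong)
  finally have f: "f = (\<lambda>x. \<Sum>i\<le>k. c i 0 * x$1 ^ i)" by auto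
  define g where "g = (\<lambda>x::real^2. \<Sum>i\<le>k. c i 0 / real (Suc i) * x$1 ^ Suc i * x$2 ^ 0)"
  have "g \<in> polyn (Suc k)"
    unfolding g_def by (intro polyn_sum polyn_monom) auto
  moreover have "(g has_derivative (\<lambda>h. h$1 * f x + h$2 * 0)) (at x)" for x
  proof -
    have "(g has_derivative (\<lambda>h. \<Sum>i\<le>k. 
      h$1 * (c i 0 / real (Suc i) * real (Suc i) * (x$1)^(Suc i - 1) * (x$2)^0)
       + h$2 * (c i 0 / real (Suc i) * real 0 * (x$1)^Suc i * (x$2)^(0 - 1)))) (at x)"
      unfolding g_def by (intro has_derivative_sum monom_has_derivative)
    then show ?thesis by (simp add: f sum_distrib_left)
  qed
  ultimately show ?thesis using pd_eqI[of g f "\<lambda>x. 0"] by blast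
qed

text \<open>
  Integrating \<open>p\<close> in the second variable gives \<open>G\<close> with the right second derivative.  The error
  \<open>q + pd 1 G\<close> in the other equation is independent of the second variable precisely because the field
  is divergence free, so it can be removed by integrating in the first variable.
\<close>

lemma polyn_curl_potential:
  assumes p: "p \<in> polyn k" "q \<in> polyn k" and div: "\<And>x. pd 1 p x + pd 2 q x = 0"
  shows "\<exists>g \<in> polyn (Suc k). pd 2 g = p \<and> pd 1 g = (\<lambda>x. - q x)"
proof -
  obtain G where G: "G \<in> polyn (Suc k)" "pd 2 G = p"
    using polyn_antiderivative[OF p(1)] by blast
  have G1: "pd 1 G \<in> polyn k" using polyn_pd[OF G(1), of 1] by simp
  have "pd 2 (\<lambda>x. q x + pd 1 G x) = (\<lambda>x. pd 2 q x + pd 1 p x)"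
    using pd_add[OF p(2) G1, of 2] pd_commute[OF G(1)] G(2) by simp
  also have "\<dots> = (\<lambda>x. 0)" using div by (simp add: add.commute)
  finally obtain h where h: "h \<in> polyn (Suc k)" "pd 1 h = (\<lambda>x. q x + pd 1 G x)" "pd 2 h = (\<lambda>x. 0)"
    using polyn_antiderivative_fst[OF polyn_add[OF p(2) G1]] by auto
  define g where "g = (\<lambda>x. G x + (-1) * h x)"
  have h': "(\<lambda>x. (-1) * h x) \<in> polyn (Suc k)" by (rule polyn_cmul[OF h(1)])
  have "g \<in> polyn (Suc k)" unfolding g_def by (rule polyn_add[OF G(1) h'])
  moreover have "pd i g = (\<lambda>x. pd i G x - pd i h x)" for i
    unfolding g_def by (simp only: pd_add[OF G(1) h'] pd_cmul[OF h(1)]) simp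
  ultimately show ?thesis using h G by (intro bexI[of _ g]) auto
qed

text \<open>
  Restriction to a line is how the total degree is detected.
\<close>

lemma polyn_along_line:
  assumes "f \<in> polyn k"
  shows "\<exists>p::real poly. degree p \<le> k \<and> (\<forall>t. f (x + t *\<^sub>R v) = poly p t)"
  using assms
proof (induction rule: polyn_induct)
  case zero
  show ?case by (intro exI[of _ 0]) auto
next
  case (add f g)
  obtain p where p: "degree p \<le> k" "\<forall>t. f (x + t *\<^sub>R v) = poly p t" using add(3) by blast
  obtain q where q: "degree q \<le> k" "\<forall>t. g (x + t *\<^sub>R v) = poly q t" using add(4) by blast
  show ?case using p q by (intro exI[of _ "p + q"]) (simp add: degree_add_le)
next
  case (monom c i j)
  let ?p = "[:x$1, v$1:] ^ i" and ?q = "[:x$2, v$2:] ^ j"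
  have "degree ?p \<le> i" "degree ?q \<le> j"
    using order_trans[OF degree_power_le mult_le_mono1[of "degree [:x$1, v$1:]" 1 i]]
      order_trans[OF degree_power_le mult_le_mono1[of "degree [:x$2, v$2:]" 1 j]] by simp_all
  then have "degree (smult c (?p * ?q)) \<le> k"
    using degree_smult_le[of c "?p * ?q"] degree_mult_le[of ?p ?q] monom by linarith
  then show ?case
    by (intro exI[of _ "smult c (?p * ?q)"]) (simp add: mult.assoc)
qed

lemma polyn_real_polynomial_function: "f \<in> polyn k \<Longrightarrow> real_polynomial_function f"
proof (induction rule: polyn_induct)
  case (monom c i j)
  show ?case by (intro real_polynomial_function.intros real_polynomial_function_power bounded_linear_vec_nth)
qed (auto intro: real_polynomial_function.intros)

text \<open>
  On the line from an interior point of \<open>S\<close> to \<open>x\<close> the function is a univariate polynomial with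
  infinitely many zeros.
\<close>

lemma real_polynomial_function_zero_of_open:
  assumes f: "real_polynomial_function f" and "interior S \<noteq> {}"
    and zero: "\<And>x. x \<in> S \<Longrightarrow> f x = 0"
  shows "f x = 0"
proof -
  obtain z where "z \<in> interior S" using assms(2) by blast
  then obtain e where e: "e > 0" "ball z e \<subseteq> S" using mem_interior by blast
  define g where "g = f \<circ> (\<lambda>t::real. z + t *\<^sub>R (x - z))"
  have "polynomial_function (\<lambda>t::real. z + t *\<^sub>R (x - z))"
    by (intro polynomial_function_add polynomial_function_const polynomial_function_mult polynomial_function_id)
  then have "real_polynomial_function g" unfolding g_def
    by (rule real_polynomial_function_compose[OF _ f])
  then obtain a n where g: "g = (\<lambda>t. \<Sum>i\<le>n. a i * t ^ i)"
    using real_polynomial_function_imp_sum by blast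
  define d where "d = e / (norm (x - z) + 1)"
  have d: "d > 0" using e by (simp add: d_def add_nonneg_pos)
  have "g t = 0" if "t \<in> {0..<d}" for t
  proof -
    have "norm (t *\<^sub>R (x - z)) \<le> t * (norm (x - z) + 1)" using that by (simp add: mult_left_mono)
    also have "\<dots> < d * (norm (x - z) + 1)" using that by (intro mult_strict_right_mono) (auto intro: add_nonneg_pos)
    also have "\<dots> = e" unfolding d_def
      using add_nonneg_pos[OF norm_ge_zero[of "x - z"] zero_less_one] by simp
    finally have "z + t *\<^sub>R (x - z) \<in> S" by (intro subsetD[OF e(2)]) (simp add: dist_norm)
    then show ?thesis by (simp add: g_def zero)
  qed
  then have "{0..<d} \<subseteq> {t. (\<Sum>i\<le>n. a i * t ^ i) = 0}" by (auto simp: g)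
  then have "infinite {t. (\<Sum>i\<le>n. a i * t ^ i) = 0}"
    using d infinite_Ico[of 0 d] finite_subset by blast
  then have "\<forall>i\<le>n. a i = 0" using polyfun_rootbound_finite[of n a] by blast
  then have "g 1 = 0" by (simp add: g)
  then show ?thesis by (simp add: g_def)
qed

lemma polyn_eq_on_open:
  assumes "f \<in> polyn k" "g \<in> polyn l" "interior S \<noteq> {}" "on_set S f = on_set S g"
  shows "f = g"
proof
  fix x
  have "real_polynomial_function (\<lambda>x. f x - g x)"
    using assms(1,2) by (intro real_polynomial_function_diff polyn_real_polynomial_function)
  from real_polynomial_function_zero_of_open[OF this assms(3), of x]
  show "f x = g x" using assms(4) by (auto simp: on_set_eq_iff)
qed

definition homog :: "nat \<Rightarrow> (real^2 \<Rightarrow> real) set" where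
  "homog k = {(\<lambda>x. \<Sum>i\<le>k. c i * (x$1) ^ i * (x$2) ^ (k - i)) |c. True}"

lemma hom_poly_space_eq: "hom_poly_space k E = on_set E ` homog k"
  by (auto simp: hom_poly_space_def homog_def)

lemma homog_polyn: "q \<in> homog k \<Longrightarrow> q \<in> polyn k"
  unfolding homog_def by (auto intro!: polyn_sum polyn_monom)

text \<open>
  The second part is Euler's identity for homogeneous functions, in divergence form.
\<close>

lemma div_position_homog:
  assumes "q \<in> homog k"
  shows "(\<lambda>x. x$i * q x) \<in> polyn (Suc k)"
    and "pd 1 (\<lambda>x. x$1 * q x) x + pd 2 (\<lambda>x. x$2 * q x) x = real (k + 2) * q x"
proof -
  obtain c where q: "q = (\<lambda>x. \<Sum>i\<le>k. c i * (x$1) ^ i * (x$2) ^ (k - i))"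
    using assms by (auto simp: homog_def)
  have q1: "(\<lambda>x. x$1 * q x) = (\<lambda>x. \<Sum>i\<le>k. c i * (x$1) ^ Suc i * (x$2) ^ (k - i))"
    by (auto simp: q sum_distrib_left intro!: sum.cong)
  have q2: "(\<lambda>x. x$2 * q x) = (\<lambda>x. \<Sum>i\<le>k. c i * (x$1) ^ i * (x$2) ^ Suc (k - i))"
    by (auto simp: q sum_distrib_left intro!: sum.cong)
  show "(\<lambda>x. x$i * q x) \<in> polyn (Suc k)"
    using exhaust_2[of i] by (auto simp only: q1 q2 intro!: polyn_sum polyn_monom)
  have "pd 1 (\<lambda>x. x$1 * q x) x = (\<Sum>i\<le>k. real (Suc i) * (c i * (x$1) ^ i * (x$2) ^ (k - i)))"
  proof -
    have "((\<lambda>x. x$1 * q x) has_derivative (\<lambda>h. \<Sum>i\<le>k. 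
      h$1 * (c i * real (Suc i) * (x$1)^(Suc i-1) * (x$2)^(k-i)) + h$2 * (c i * real (k-i) * (x$1)^Suc i * (x$2)^(k-i-1)))) (at x)"
      unfolding q1 by (intro has_derivative_sum monom_has_derivative)
    from partial_on_UNIV_eqI[OF this, of 1] show ?thesis by (simp add: axis_def algebra_simps sum.distrib)
  qed
  moreover have "pd 2 (\<lambda>x. x$2 * q x) x = (\<Sum>i\<le>k. real (Suc (k - i)) * (c i * (x$1) ^ i * (x$2) ^ (k - i)))"
  proof -
    have "((\<lambda>x. x$2 * q x) has_derivative (\<lambda>h. \<Sum>i\<le>k. 
      h$1 * (c i * real i * (x$1)^(i-1) * (x$2)^Suc (k-i)) + h$2 * (c i * real (Suc (k-i)) * (x$1)^i * (x$2)^(Suc (k-i)-1)))) (at x)"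
      unfolding q2 by (intro has_derivative_sum monom_has_derivative)
    from partial_on_UNIV_eqI[OF this, of 2] show ?thesis by (simp add: axis_def algebra_simps sum.distrib)
  qed
  ultimately show "pd 1 (\<lambda>x. x$1 * q x) x + pd 2 (\<lambda>x. x$2 * q x) x = real (k + 2) * q x"
    by (auto simp: q sum_distrib_left sum.distrib[symmetric] algebra_simps intro!: sum.cong)

qed

lemma homog_polyn_zero:
  assumes q: "q \<in> homog k" and "q \<in> polyn l" "l < k"
  shows "q x = 0"
proof -
  obtain c where c: "q = (\<lambda>x. \<Sum>i\<le>k. c i * (x$1) ^ i * (x$2) ^ (k - i))"
    using q by (auto simp: homog_def)
  have "q (t *\<^sub>R x) = t ^ k * q x" for t
    unfolding c sum_distrib_left
    by (rule sum.cong) (auto simp: power_mult_distrib power_add[symmetric] algebra_simps)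
  moreover obtain p where p: "degree p \<le> l" "\<forall>t. q (0 + t *\<^sub>R x) = poly p t"
    using polyn_along_line[OF assms(2)] by metis
  ultimately have "poly p = poly (monom (q x) k)"
    by (auto simp: poly_monom fun_eq_iff mult.commute)
  then have "p = monom (q x) k" by (simp add: poly_eq_poly_eq_iff)
  then show ?thesis using p(1) assms(3) by (metis degree_monom_eq linorder_not_less)
qed

lemma has_partials_polyn: "f \<in> polyn k \<Longrightarrow> has_partials E f (pd 1 f) (pd 2 f)"
  using polyn_has_derivative by (auto simp: has_partials_def intro: has_derivative_at_withinI)

lemma homog_add: 
  assumes "f \<in> homog k" "g \<in> homog k" shows "(\<lambda>x. f x + g x) \<in> homog k"
proof -
  obtain c d where "f = (\<lambda>x. \<Sum>i\<le>k. c i * (x$1) ^ i * (x$2) ^ (k - i))"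
    "g = (\<lambda>x. \<Sum>i\<le>k. d i * (x$1) ^ i * (x$2) ^ (k - i))"
    using assms by (auto simp: homog_def)
  then show ?thesis unfolding homog_def
    by (auto simp: sum.distrib algebra_simps intro!: exI[of _ "\<lambda>i. c i + d i"])
qed

lemma homog_monom: "i \<le> k \<Longrightarrow> (\<lambda>x. c * (x$1)^i * (x$2)^(k - i)) \<in> homog k"
  unfolding homog_def
  by (intro CollectI exI[of _ "\<lambda>i'. if i' = i then c else 0"] conjI TrueI)
    (auto simp: fun_eq_iff if_distrib[of "\<lambda>a. a * _"] cong: if_cong)

lemma homog_zero: "(\<lambda>x. 0) \<in> homog k"
  using homog_monom[of 0 k 0] by simp

lemma polyn_split_homog:
  assumes "g \<in> polyn (Suc k)"
  shows "\<exists>f\<in>polyn k. \<exists>h\<in>homog (Suc k). g = (\<lambda>x. f x + h x)"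
  using assms
proof (induction rule: polyn_induct)
  case zero
  show ?case using polyn_const[of 0 k] homog_zero[of "Suc k"]
    by (intro bexI[of _ "\<lambda>x. 0"]) auto
next
  case (add g1 g2)
  obtain f1 h1 where 1: "f1 \<in> polyn k" "h1 \<in> homog (Suc k)" "g1 = (\<lambda>x. f1 x + h1 x)" using add(3) by blast
  obtain f2 h2 where 2: "f2 \<in> polyn k" "h2 \<in> homog (Suc k)" "g2 = (\<lambda>x. f2 x + h2 x)" using add(4) by blast
  show ?case using 1 2
    by (intro bexI[of _ "\<lambda>x. f1 x + f2 x"] bexI[of _ "\<lambda>x. h1 x + h2 x"] polyn_add homog_add) auto
next
  case (monom c i j)
  show ?case
  proof (cases "i + j \<le> k")
    case True
    then show ?thesis using polyn_monom[OF True, of c] homog_zero[of "Suc k"]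
      by (intro bexI[of _ "\<lambda>x. c * x$1^i * x$2^j"] bexI[of _ "\<lambda>x. 0"]) auto
  next
    case False
    then have "j = Suc k - i" "i \<le> Suc k" using monom by auto
    then show ?thesis using homog_monom[of i "Suc k" c] polyn_const[of 0 k]
      by (intro bexI[of _ "\<lambda>x. 0"] bexI[of _ "\<lambda>x. c * x$1^i * x$2^j"]) auto
  qed
qed

section \<open>The bilinear chart\<close>

text \<open>
  The Jacobian determinant of \<open>y \<mapsto> y$1 A + y$2 B + y$1 y$2 C\<close>; it is affine in \<open>y\<close>, since the
  quadratic terms cancel.
\<close>

definition bilin_det :: "real^2 \<Rightarrow> real^2 \<Rightarrow> real^2 \<Rightarrow> real^2 \<Rightarrow> real" where
  "bilin_det A B C y = (A$1 + C$1 * y$2) * (B$2 + C$2 * y$1) - (B$1 + C$1 * y$1) * (A$2 + C$2 * y$2)"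

lemma convex_ref_square: "convex ref_square"
proof -
  have "ref_square = {y. y$1 \<le> 1} \<inter> {y. y$1 \<ge> -1} \<inter> {y. y$2 \<le> 1} \<inter> {y. y$2 \<ge> -1}"
    by (auto simp: ref_square_def)
  moreover have "convex {y::real^2. y$i \<le> 1}" "convex {y::real^2. y$i \<ge> -1}" for i
    using convex_halfspace_le[of "axis i (1::real)" 1] convex_halfspace_ge[of "-1" "axis i (1::real)"]
    by (simp_all add: inner_axis' )
  ultimately show ?thesis by (metis convex_Int)
qed

definition open_square :: "(real^2) set" where
  "open_square = {y. \<bar>y$1\<bar> < 1 \<and> \<bar>y$2\<bar> < 1}"

lemma open_open_square: "open open_square"
  unfolding open_square_def by (intro open_Collect_conj open_Collect_less continuous_intros)

lemma open_square_subset: "open_square \<subseteq> ref_square" and zero_in_open_square: "0 \<in> open_square"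
  by (auto simp: open_square_def ref_square_def)

lemma interior_ref_square: "interior ref_square \<noteq> {}"
  using interior_maximal[OF open_square_subset open_open_square] zero_in_open_square by blast

interpretation ref: convex_body ref_square
  by standard (rule convex_ref_square interior_ref_square)+

text \<open>
  A general combination of the two supplements in scalar coordinates, where the symmetry \<open>bub_swap\<close>
  between the two variables is visible.
\<close>

definition bub :: "nat \<Rightarrow> real \<Rightarrow> real \<Rightarrow> real \<Rightarrow> real \<Rightarrow> real" where
  "bub r \<alpha> \<beta> u v = \<alpha> * ((1 - v\<^sup>2) * u * v ^ (r - 1)) + \<beta> * ((1 - u\<^sup>2) * v * u ^ (r - 1))"

definition bubble :: "nat \<Rightarrow> real \<Rightarrow> real \<Rightarrow> real^2 \<Rightarrow> real" where
  "bubble r \<alpha> \<beta> y = bub r \<alpha> \<beta> (y$1) (y$2)"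

lemma bubble_eq: "bubble r \<alpha> \<beta> y = \<alpha> * suppl1 r y + \<beta> * suppl2 r y"
  by (simp add: bubble_def bub_def suppl1_def suppl2_def)

lemma suppl_polyn:
  assumes "r \<ge> 1"
  shows "suppl1 r \<in> polyn (r + 2)" "suppl2 r \<in> polyn (r + 2)"
proof -
  obtain n where r: "r = Suc n" using assms by (cases r) auto
  have "suppl1 r = (\<lambda>y. 1 * y$1 ^ 1 * y$2 ^ n + (-1) * y$1 ^ 1 * y$2 ^ (n + 2))"
    "suppl2 r = (\<lambda>y. 1 * y$1 ^ n * y$2 ^ 1 + (-1) * y$1 ^ (n + 2) * y$2 ^ 1)"
    by (auto simp: suppl1_def suppl2_def r fun_eq_iff power_add power2_eq_square algebra_simps)
  then show "suppl1 r \<in> polyn (r + 2)" "suppl2 r \<in> polyn (r + 2)"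
    by (auto simp only: r intro!: polyn_add polyn_monom)
qed

lemma bubble_polyn: "r \<ge> 1 \<Longrightarrow> bubble r \<alpha> \<beta> \<in> polyn (r + 2)"
  unfolding bubble_eq[abs_def] by (intro polyn_add polyn_cmul suppl_polyn)

text \<open>
  All properties of the quadrilateral that are used afterwards: it is the convex image of the square
  under a bilinear map whose determinant has the constant sign \<open>\<sigma>\<close> on the closed square.
\<close>

locale bilinear_chart =
  fixes p0 A B C :: "real^2" and E :: "(real^2) set" and F :: "real^2 \<Rightarrow> real^2" and \<sigma> :: real
  assumes F: "F = (\<lambda>y. p0 + y$1 *\<^sub>R A + y$2 *\<^sub>R B + (y$1 * y$2) *\<^sub>R C)"
    and image: "F ` ref_square = E"
    and convex_E: "convex E"
    and sign: "\<bar>\<sigma>\<bar> = 1"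
    and det_pos: "\<And>y. y \<in> ref_square \<Longrightarrow> \<sigma> * bilin_det A B C y > 0"
begin

abbreviation J :: "real^2 \<Rightarrow> real" where "J \<equiv> bilin_det A B C"
definition F11 :: "real^2 \<Rightarrow> real" where "F11 y = A$1 + C$1 * y$2"
definition F12 :: "real^2 \<Rightarrow> real" where "F12 y = B$1 + C$1 * y$1"
definition F21 :: "real^2 \<Rightarrow> real" where "F21 y = A$2 + C$2 * y$2"
definition F22 :: "real^2 \<Rightarrow> real" where "F22 y = B$2 + C$2 * y$1"
lemmas F_defs = F11_def F12_def F21_def F22_def

lemma J_eq: "J y = F11 y * F22 y - F12 y * F21 y"
  by (simp add: bilin_det_def F_defs)

definition dF :: "real^2 \<Rightarrow> real^2 \<Rightarrow> real^2" where
  "dF y h = vector [F11 y * h$1 + F12 y * h$2, F21 y * h$1 + F22 y * h$2]"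

definition dG :: "real^2 \<Rightarrow> real^2 \<Rightarrow> real^2" where
  "dG y h = vector [(F22 y * h$1 - F12 y * h$2) / J y, (F11 y * h$2 - F21 y * h$1) / J y]"

lemma F_has_derivative: "(F has_derivative dF y) (at y)"
proof -
  have "(F has_derivative (\<lambda>h. h$1 *\<^sub>R A + h$2 *\<^sub>R B + (y$1 * h$2 + h$1 * y$2) *\<^sub>R C)) (at y)"
    unfolding F by (auto intro!: derivative_eq_intros)
  then show ?thesis
    by (rule has_derivative_eq_rhs) (simp add: fun_eq_iff vector_2_eq_iff dF_def F_defs algebra_simps)
qed

text \<open>
  Since the determinant is affine, this is an open half-plane or the whole plane.  Inverting \<open>F\<close> on it,
  instead of on the closed square, avoids one-sided inverse function arguments at the boundary.
\<close>

definition H :: "(real^2) set" where "H = {y. \<sigma> * J y > 0}"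

lemma open_H: "open H"
  unfolding H_def bilin_det_def by (intro open_Collect_less continuous_intros)

lemma ref_subset_H: "ref_square \<subseteq> H"
  using det_pos by (auto simp: H_def)

text \<open>
  As \<open>F\<close> is quadratic, \<open>F y - F z\<close> is exactly the derivative of \<open>F\<close> at the midpoint of \<open>y\<close> and \<open>z\<close>
  applied to \<open>y - z\<close>, and the midpoint stays in the half-plane.
\<close>

lemma inj_on_H: "inj_on F H"
proof (rule inj_onI)
  fix y z assume yz: "y \<in> H" "z \<in> H" "F y = F z"
  define m where "m = (1/2) *\<^sub>R (y + z)"
  have "\<sigma> * J m = (\<sigma> * J y + \<sigma> * J z) / 2"
    by (simp add: m_def bilin_det_def field_simps)
  then have "J m \<noteq> 0" using yz by (auto simp: H_def)
  have "dF m (y - z) = F y - F z"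
    by (simp add: m_def dF_def F F_defs vector_2_eq_iff field_simps)
  then have z: "F11 m * (y - z)$1 + F12 m * (y - z)$2 = 0" "F21 m * (y - z)$1 + F22 m * (y - z)$2 = 0"
    using yz(3) by (auto simp: dF_def vector_2_eq_iff)
  then have "J m * (y - z)$1 = 0" "J m * (y - z)$2 = 0" unfolding J_eq by algebra+
  then show "y = z" using \<open>J m \<noteq> 0\<close> by (simp add: vector_2_eq_iff)
qed

lemma inj_on_ref: "inj_on F ref_square"
  using inj_on_H ref_subset_H by (rule inj_on_subset)

lemma interior_E: "interior E \<noteq> {}"
proof -
  have "continuous_on open_square F" 
    using F_has_derivative by (meson continuous_at_imp_continuous_on has_derivative_continuous)
  moreover have "inj_on F open_square" using inj_on_ref open_square_subset by (rule inj_on_subset)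
  ultimately have "open (F ` open_square)"
    using open_open_square by (intro invariance_of_domain)
  moreover have "F ` open_square \<subseteq> E" using image open_square_subset by blast
  ultimately show ?thesis using interior_maximal zero_in_open_square by blast
qed

sublocale convex_body E
  by standard (rule convex_E interior_E)+

definition G :: "real^2 \<Rightarrow> real^2" where "G = inv_into ref_square F"

lemma G_ref: "x \<in> E \<Longrightarrow> G x \<in> ref_square"
  unfolding G_def image[symmetric] by (rule inv_into_into)

lemma F_G: "x \<in> E \<Longrightarrow> F (G x) = x"
  unfolding G_def image[symmetric] by (rule f_inv_into_f)

lemma G_F: "y \<in> ref_square \<Longrightarrow> G (F y) = y"
  unfolding G_def using inj_on_ref by (rule inv_into_f_f)

lemma J_nz: "x \<in> E \<Longrightarrow> J (G x) \<noteq> 0"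
  using G_ref det_pos[of "G x"] by auto

text \<open>
  On \<open>E\<close> the map \<open>G\<close> agrees with the inverse of \<open>F\<close> on the open half-plane, which is differentiable at
  every point of \<open>E\<close>, boundary points included.
\<close>

lemma G_has_derivative:
  assumes "x \<in> E" shows "(G has_derivative dG (G x)) (at x within E)"
proof -
  let ?G = "inv_into H F"
  have "dF (G x) \<circ> dG (G x) = id"
    using J_nz[OF assms]
    by (auto simp: dF_def dG_def fun_eq_iff vector_2_eq_iff divide_simps) (auto simp: J_eq algebra_simps)
  moreover have "continuous_on H F" 
    using F_has_derivative by (meson continuous_at_imp_continuous_on has_derivative_continuous)
  ultimately have "(?G has_derivative dG (G x)) (at (F (G x)))"
    using G_ref[OF assms] ref_subset_H inj_on_H
    by (intro has_derivative_inverse_strong[OF open_H _ _ _ F_has_derivative]) auto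
  then have "(?G has_derivative dG (G x)) (at x within E)"
    by (simp add: F_G[OF assms] has_derivative_at_withinI)
  moreover have "?G z = G z" if "z \<in> E" for z
    using inv_into_f_f[OF inj_on_H, of "G z"] F_G[OF that] G_ref[OF that] ref_subset_H by auto
  ultimately show ?thesis
    by (rule has_derivative_transform_within[OF _ zero_less_one assms])
qed

lemma has_partials_compose_G:
  assumes "\<And>y. y \<in> ref_square \<Longrightarrow> (g has_derivative (\<lambda>h. h$1 * g1 y + h$2 * g2 y)) (at y)"
  shows "has_partials E (\<lambda>x. g (G x))
     (\<lambda>x. (F22 (G x) * g1 (G x) - F21 (G x) * g2 (G x)) / J (G x))
     (\<lambda>x. (F11 (G x) * g2 (G x) - F12 (G x) * g1 (G x)) / J (G x))"
  unfolding has_partials_def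
proof
  fix x assume x: "x \<in> E"
  show "((\<lambda>x. g (G x)) has_derivative
     (\<lambda>h. h$1 * ((F22 (G x) * g1 (G x) - F21 (G x) * g2 (G x)) / J (G x))
        + h$2 * ((F11 (G x) * g2 (G x) - F12 (G x) * g1 (G x)) / J (G x)))) (at x within E)"
    by (rule has_derivative_eq_rhs[OF has_derivative_compose[OF G_has_derivative[OF x] assms[OF G_ref[OF x]]]])
      (auto simp: dG_def fun_eq_iff algebra_simps add_divide_distrib diff_divide_distrib)
qed

end

section \<open>The supplements and the Piola map\<close>

context bilinear_chart begin

text \<open>
  The components of \<open>(1 / J) DF (curl f)\<close> in reference coordinates: the Piola transform of the curl of
  \<open>f\<close>, but with the oriented determinant in place of its absolute value.
\<close>

definition flux1 :: "(real^2 \<Rightarrow> real) \<Rightarrow> real^2 \<Rightarrow> real" where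
  "flux1 f y = (F11 y * pd 2 f y - F12 y * pd 1 f y) / J y"
definition flux2 :: "(real^2 \<Rightarrow> real) \<Rightarrow> real^2 \<Rightarrow> real" where
  "flux2 f y = (F21 y * pd 2 f y - F22 y * pd 1 f y) / J y"

lemma has_partials_pull0:
  assumes "f \<in> polyn k"
  shows "has_partials E (pull0 F E f) (\<lambda>x. - flux2 f (G x)) (\<lambda>x. flux1 f (G x))"
proof -
  have "has_partials E (\<lambda>x. f (G x)) (\<lambda>x. - flux2 f (G x)) (\<lambda>x. flux1 f (G x))"
    using has_partials_compose_G[OF polyn_has_derivative[OF assms]]
    by (simp add: flux1_def flux2_def minus_divide_left)
  then show ?thesis by (auto simp: pull0_def G_def intro: has_partials_on_set)
qed

text \<open>
  Together with \<open>piola_curl\<close>: the Piola map commutes with the curl, up to the sign \<open>\<sigma>\<close>.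
\<close>

lemma curl_pull0:
  assumes "f \<in> polyn k"
  shows "curl_on E (pull0 F E f) = on_set E (\<lambda>x. vector [flux1 f (G x), flux2 f (G x)])"
  using curl_on_eq[OF has_partials_pull0[OF assms]] by simp

lemma jacobian_F: "jacobian F (at y) *v h = dF y h"
  using F_has_derivative[of y] 
  by (metis differentiableI frechet_derivative_at jacobian_works)

lemma det_jacobian_F: "det (jacobian F (at y)) = J y"
proof -
  have "jacobian F (at y) = matrix (dF y)"
    using frechet_derivative_at[OF F_has_derivative[of y]] by (simp add: jacobian_def)
  then show ?thesis
    by (simp add: det_2 matrix_def dF_def axis_def J_eq)
qed

lemma abs_J: "y \<in> ref_square \<Longrightarrow> \<bar>J y\<bar> = \<sigma> * J y"
  using det_pos[of y] sign by (metis abs_mult abs_of_pos mult_1)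

lemma piola_curl:
  assumes "f \<in> polyn k"
  shows "piola F E (curl_on ref_square f) = on_set E (\<lambda>x. \<sigma> *\<^sub>R vector [flux1 f (G x), flux2 f (G x)])"
  unfolding piola_def
proof (rule on_set_cong)
  fix x assume x: "x \<in> E"
  have \<sigma>: "1 / \<sigma> = \<sigma>" using sign by (auto simp: abs_if field_simps split: if_splits)
  let ?y = "G x"
  have "curl_on ref_square f ?y = vector [pd 2 f ?y, - pd 1 f ?y]"
    using ref.curl_on_eq[OF has_partials_polyn[OF assms]] G_ref[OF x] by (simp add: on_set_def)
  then have "(1 / \<bar>J ?y\<bar>) *\<^sub>R dF ?y (curl_on ref_square f ?y) = \<sigma> *\<^sub>R vector [flux1 f ?y, flux2 f ?y]"
    by (simp add: abs_J[OF G_ref[OF x]] dF_def vector_2_eq_iff flux1_def flux2_def)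
      (use \<sigma> in \<open>simp add: divide_simps\<close>)
  then show "(let y = inv_into ref_square F x; DF = jacobian F (at y)
      in (1 / \<bar>det DF\<bar>) *\<^sub>R (DF *v curl_on ref_square f y)) = \<sigma> *\<^sub>R vector [flux1 f ?y, flux2 f ?y]"
    by (simp add: Let_def G_def[symmetric] jacobian_F det_jacobian_F)
qed


text \<open>
  This is the Piola identity \<open>div (F\<^sup>1 \<psi>) = (div \<psi>) / J\<close> for \<open>\<psi> = curl f\<close>.  Beyond the symmetry of
  the second derivatives of \<open>f\<close> it is a polynomial identity in the entries of \<open>DF\<close>.
\<close>

lemma flux_divergence_free:
  assumes f: "f \<in> polyn k"
  obtains p1 p2 q1 q2 where
    "has_partials E (\<lambda>x. flux1 f (G x)) p1 p2" "has_partials E (\<lambda>x. flux2 f (G x)) q1 q2"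
    "\<forall>x\<in>E. p1 x + q2 x = 0"
proof -
  let ?f1 = "pd 1 f" and ?f2 = "pd 2 f"
  let ?f11 = "pd 1 ?f1" and ?f12 = "pd 2 ?f1" and ?f22 = "pd 2 ?f2"
  have f1: "(?f1 has_derivative (\<lambda>h. h$1 * ?f11 y + h$2 * ?f12 y)) (at y)" for y
    by (rule polyn_has_derivative[OF polyn_pd[OF f]])
  have f2: "(?f2 has_derivative (\<lambda>h. h$1 * ?f12 y + h$2 * ?f22 y)) (at y)" for y
    using polyn_has_derivative[OF polyn_pd[OF f], of 2] by (simp add: pd_commute[OF f])
  define J1 where "J1 y = F11 y * C$2 - C$1 * F21 y" for y
  define J2 where "J2 y = C$1 * F22 y - F12 y * C$2" for y
  have J: "(J has_derivative (\<lambda>h. h$1 * J1 y + h$2 * J2 y)) (at y)" for y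
    unfolding bilin_det_def
    by (auto intro!: derivative_eq_intros simp: fun_eq_iff J1_def J2_def F_defs algebra_simps)
  define n11 where "n11 y = F11 y * ?f12 y - C$1 * ?f1 y - F12 y * ?f11 y" for y
  define n12 where "n12 y = C$1 * ?f2 y + F11 y * ?f22 y - F12 y * ?f12 y" for y
  define n21 where "n21 y = F21 y * ?f12 y - C$2 * ?f1 y - F22 y * ?f11 y" for y
  define n22 where "n22 y = C$2 * ?f2 y + F21 y * ?f22 y - F22 y * ?f12 y" for y
  define N1 where "N1 y = F11 y * ?f2 y - F12 y * ?f1 y" for y
  define N2 where "N2 y = F21 y * ?f2 y - F22 y * ?f1 y" for y
  have N1: "(N1 has_derivative (\<lambda>h. h$1 * n11 y + h$2 * n12 y)) (at y)" for y
    unfolding N1_def F_defs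
    by (auto intro!: derivative_eq_intros f1 f2 simp: fun_eq_iff n11_def n12_def F_defs algebra_simps)
  have N2: "(N2 has_derivative (\<lambda>h. h$1 * n21 y + h$2 * n22 y)) (at y)" for y
    unfolding N2_def F_defs
    by (auto intro!: derivative_eq_intros f1 f2 simp: fun_eq_iff n21_def n22_def F_defs algebra_simps)
  have quot: "((\<lambda>y. N y / J y) has_derivative (\<lambda>h. h$1 * ((n1 y * J y - N y * J1 y) / (J y * J y))
      + h$2 * ((n2 y * J y - N y * J2 y) / (J y * J y)))) (at y)"
    if "\<And>y. (N has_derivative (\<lambda>h. h$1 * n1 y + h$2 * n2 y)) (at y)" "y \<in> ref_square" for N n1 n2 y
    using det_pos[OF that(2)]
    by (intro has_derivative_eq_rhs[OF has_derivative_divide'[OF that(1) J]])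
      (auto simp: fun_eq_iff add_divide_distrib diff_divide_distrib algebra_simps)
  have flux: "flux1 f = (\<lambda>y. N1 y / J y)" "flux2 f = (\<lambda>y. N2 y / J y)"
    by (simp_all add: fun_eq_iff flux1_def flux2_def N1_def N2_def)
  show thesis
  proof (rule that)
    show "has_partials E (\<lambda>x. flux1 f (G x))
     (\<lambda>x. (F22 (G x) * ((n11 (G x) * J (G x) - N1 (G x) * J1 (G x)) / (J (G x) * J (G x)))
         - F21 (G x) * ((n12 (G x) * J (G x) - N1 (G x) * J2 (G x)) / (J (G x) * J (G x)))) / J (G x))
     (\<lambda>x. (F11 (G x) * ((n12 (G x) * J (G x) - N1 (G x) * J2 (G x)) / (J (G x) * J (G x)))
         - F12 (G x) * ((n11 (G x) * J (G x) - N1 (G x) * J1 (G x)) / (J (G x) * J (G x)))) / J (G x))"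
      unfolding flux by (rule has_partials_compose_G[OF quot[OF N1]])
    show "has_partials E (\<lambda>x. flux2 f (G x))
     (\<lambda>x. (F22 (G x) * ((n21 (G x) * J (G x) - N2 (G x) * J1 (G x)) / (J (G x) * J (G x)))
         - F21 (G x) * ((n22 (G x) * J (G x) - N2 (G x) * J2 (G x)) / (J (G x) * J (G x)))) / J (G x))
     (\<lambda>x. (F11 (G x) * ((n22 (G x) * J (G x) - N2 (G x) * J2 (G x)) / (J (G x) * J (G x)))
         - F12 (G x) * ((n21 (G x) * J (G x) - N2 (G x) * J1 (G x)) / (J (G x) * J (G x)))) / J (G x))"
      unfolding flux by (rule has_partials_compose_G[OF quot[OF N2]])
    show "\<forall>x\<in>E. (F22 (G x) * ((n11 (G x) * J (G x) - N1 (G x) * J1 (G x)) / (J (G x) * J (G x)))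
         - F21 (G x) * ((n12 (G x) * J (G x) - N1 (G x) * J2 (G x)) / (J (G x) * J (G x)))) / J (G x)
        + (F11 (G x) * ((n22 (G x) * J (G x) - N2 (G x) * J2 (G x)) / (J (G x) * J (G x)))
         - F12 (G x) * ((n21 (G x) * J (G x) - N2 (G x) * J1 (G x)) / (J (G x) * J (G x)))) / J (G x) = 0"
    proof
    fix x assume x: "x \<in> E"
    let ?y = "G x"
    have "F22 ?y * (n11 ?y * J ?y - N1 ?y * J1 ?y) - F21 ?y * (n12 ?y * J ?y - N1 ?y * J2 ?y)
        + F11 ?y * (n22 ?y * J ?y - N2 ?y * J2 ?y) - F12 ?y * (n21 ?y * J ?y - N2 ?y * J1 ?y) = 0"
      unfolding J_eq n11_def n12_def n21_def n22_def N1_def N2_def J1_def J2_def by algebra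
    then show "(F22 ?y * ((n11 ?y * J ?y - N1 ?y * J1 ?y) / (J ?y * J ?y))
         - F21 ?y * ((n12 ?y * J ?y - N1 ?y * J2 ?y) / (J ?y * J ?y))) / J ?y
        + (F11 ?y * ((n22 ?y * J ?y - N2 ?y * J2 ?y) / (J ?y * J ?y))
         - F12 ?y * ((n21 ?y * J ?y - N2 ?y * J1 ?y) / (J ?y * J ?y))) / J ?y = 0"
      using J_nz[OF x] by (simp add: divide_simps)
    qed
  qed
qed

lemma DS_suppl_eq: "DS_suppl r F E = {pull0 F E (bubble r \<alpha> \<beta>) |\<alpha> \<beta>. True}"
proof -
  have "(\<lambda>x. \<alpha> *\<^sub>R pull0 F E (suppl1 r) x + \<beta> *\<^sub>R pull0 F E (suppl2 r) x) = pull0 F E (bubble r \<alpha> \<beta>)" for \<alpha> \<beta>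
    by (auto simp: pull0_def on_set_def bubble_eq)
  then show ?thesis by (simp add: DS_suppl_def fun_span2_def)
qed

lemma flux_bubble:
  assumes "r \<ge> 1"
  shows "flux1 (bubble r \<alpha> \<beta>) y = \<alpha> * flux1 (suppl1 r) y + \<beta> * flux1 (suppl2 r) y"
    and "flux2 (bubble r \<alpha> \<beta>) y = \<alpha> * flux2 (suppl1 r) y + \<beta> * flux2 (suppl2 r) y"
proof -
  note s = suppl_polyn[OF assms]
  have "pd i (bubble r \<alpha> \<beta>) y = \<alpha> * pd i (suppl1 r) y + \<beta> * pd i (suppl2 r) y" for i
    unfolding bubble_eq[abs_def]
    by (simp add: pd_add[OF polyn_cmul[OF s(1)] polyn_cmul[OF s(2)]] pd_cmul[OF s(1)] pd_cmul[OF s(2)])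
  then show "flux1 (bubble r \<alpha> \<beta>) y = \<alpha> * flux1 (suppl1 r) y + \<beta> * flux1 (suppl2 r) y"
    "flux2 (bubble r \<alpha> \<beta>) y = \<alpha> * flux2 (suppl1 r) y + \<beta> * flux2 (suppl2 r) y"
    by (simp_all add: flux1_def flux2_def algebra_simps add_divide_distrib diff_divide_distrib)
qed

text \<open>
  The sign \<open>\<sigma>\<close> is absorbed into the coefficients of the linear combination.
\<close>

lemma AC_suppl_eq:
  assumes r: "r \<ge> 1" shows "AC_suppl r F E = curl_on E ` DS_suppl r F E"
proof -
  have comb: "(\<lambda>x. \<alpha> *\<^sub>R piola F E (curl_on ref_square (suppl1 r)) x
        + \<beta> *\<^sub>R piola F E (curl_on ref_square (suppl2 r)) x)
      = curl_on E (pull0 F E (bubble r (\<sigma> * \<alpha>) (\<sigma> * \<beta>)))" for \<alpha> \<beta>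
    unfolding curl_pull0[OF bubble_polyn[OF r]] suppl_polyn[OF r, THEN piola_curl]
    by (auto simp: on_set_def fun_eq_iff vector_2_eq_iff flux_bubble[OF r] algebra_simps)
  have \<sigma>: "\<sigma> * (\<sigma> * a) = a" for a using sign by (auto simp: abs_if split: if_splits)
  show ?thesis
  proof (intro equalityI subsetI)
    fix \<psi> assume "\<psi> \<in> AC_suppl r F E"
    then show "\<psi> \<in> curl_on E ` DS_suppl r F E"
      by (auto simp: AC_suppl_def fun_span2_def comb DS_suppl_eq)
  next
    fix \<psi> assume "\<psi> \<in> curl_on E ` DS_suppl r F E"
    then obtain \<alpha> \<beta> where "\<psi> = curl_on E (pull0 F E (bubble r (\<sigma> * (\<sigma> * \<alpha>)) (\<sigma> * (\<sigma> * \<beta>))))"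
      by (auto simp: DS_suppl_eq \<sigma>)
    then show "\<psi> \<in> AC_suppl r F E"
      unfolding AC_suppl_def fun_span2_def comb by blast
  qed
qed

lemma DS_suppl_has_partials:
  assumes "s \<in> DS_suppl r F E" "r \<ge> 1"
  obtains s1 s2 where "has_partials E s s1 s2"
proof -
  obtain \<alpha> \<beta> where "s = pull0 F E (bubble r \<alpha> \<beta>)" using assms by (auto simp: DS_suppl_eq)
  then show thesis using that has_partials_pull0[OF bubble_polyn[OF assms(2)]] by blast
qed

lemma DS_suppl_curl_has_partials:
  assumes "s \<in> DS_suppl r F E" "r \<ge> 1"
  obtains p1 p2 q1 q2 where
    "has_partials E (\<lambda>x. curl_on E s x $ 1) p1 p2" "has_partials E (\<lambda>x. curl_on E s x $ 2) q1 q2"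
    "\<forall>x\<in>E. p1 x + q2 x = 0"
proof -
  obtain \<alpha> \<beta> where s: "s = pull0 F E (bubble r \<alpha> \<beta>)" using assms by (auto simp: DS_suppl_eq)
  note b = bubble_polyn[OF assms(2), of \<alpha> \<beta>]
  obtain p1 p2 q1 q2 where *:
    "has_partials E (\<lambda>x. flux1 (bubble r \<alpha> \<beta>) (G x)) p1 p2" "has_partials E (\<lambda>x. flux2 (bubble r \<alpha> \<beta>) (G x)) q1 q2"
    "\<forall>x\<in>E. p1 x + q2 x = 0"
    by (rule flux_divergence_free[OF b])
  have "(\<lambda>x. curl_on E s x $ 1) = on_set E (\<lambda>x. flux1 (bubble r \<alpha> \<beta>) (G x))"
    "(\<lambda>x. curl_on E s x $ 2) = on_set E (\<lambda>x. flux2 (bubble r \<alpha> \<beta>) (G x))"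
    by (auto simp: s curl_pull0[OF b] on_set_def)
  with * that show thesis by (metis has_partials_on_set)
qed

end

section \<open>The serendipity sum is direct\<close>

text \<open>
  The map \<open>(u, v) \<mapsto> (u (1 + l v), v (1 + m u))\<close> sends \<open>(z, - 1 / l)\<close> and \<open>(0, - (1 + m z) / l)\<close> to
  the same point.  On the second line the combination is affine in \<open>z\<close>, and constantly zero for
  \<open>r > 1\<close>; on the first it has the terms \<open>\<alpha> K z\<close> with \<open>K \<noteq> 0\<close> and \<open>(\<beta> / l) z ^ (r + 1)\<close>.
\<close>

lemma bub_collapse:
  fixes l m :: real
  assumes l: "l \<noteq> 0" "\<bar>l\<bar> < 1"
    and eq: "\<And>z. bub r \<alpha> \<beta> z (- 1 / l) = bub r \<alpha> \<beta> 0 (- (1 + m * z) / l)"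
  shows "\<alpha> = 0 \<and> \<beta> = 0"
proof -
  define K where "K = (1 - (1 / l)\<^sup>2) * (- 1 / l) ^ (r - 1)"
  have "1 < 1 / \<bar>l\<bar>" using l by simp
  then have "1 < (1 / \<bar>l\<bar>)\<^sup>2" by (rule one_less_power) simp
  then have "1 - (1 / l)\<^sup>2 \<noteq> 0" by (auto simp: power_divide)
  then have K: "K \<noteq> 0" using l(1) by (simp add: K_def)
  \<comment> \<open>The value of \<open>e\<close> is \<open>\<beta>\<close> for \<open>r = 1\<close> and \<open>0\<close> otherwise.\<close>
  define e where "e = \<beta> * 0 ^ (r - 1)"
  have eq': "\<alpha> * K * z + \<beta> * ((1 - z\<^sup>2) * (- 1 / l) * z ^ (r - 1)) = e * (- (1 + m * z) / l)" for z
    using eq[of z] by (simp add: bub_def K_def e_def algebra_simps)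
  have 1: "\<alpha> * K = e * (- (1 + m) / l)" using eq'[of 1] by simp
  have 2: "- (\<alpha> * K) = e * (- (1 - m) / l)" using eq'[of "-1"] by simp
  have "e * (- (1 + m) / l) + e * (- (1 - m) / l) = e * (- 2 / l)"
    unfolding distrib_left[symmetric] add_divide_distrib[symmetric] by simp
  then have "e * (- 2 / l) = 0" using 1 2 by linarith
  then have e: "e = 0" using l(1) by simp
  then have "\<alpha> = 0" using 1 K by simp
  moreover have "\<beta> = 0"
    using eq'[of 2] \<open>\<alpha> = 0\<close> l(1) e by simp
  ultimately show ?thesis by simp
qed

lemma bub_swap: "bub r \<alpha> \<beta> u v = bub r \<beta> \<alpha> v u"
  by (simp add: bub_def)

context bilinear_chart begin

text \<open>
  Writing \<open>C = l A + m B\<close> turns \<open>F\<close> into the normal form of \<open>bub_collapse\<close>, and the constant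
  sign of the determinant \<open>\<Delta> (1 + l v + m u)\<close> at the center and at the midpoints of the sides of the
  square gives \<open>\<bar>l\<bar> < 1\<close> and \<open>\<bar>m\<bar> < 1\<close>.  The degree of \<open>f\<close> matters only if \<open>l = m = 0\<close>, that is, if \<open>F\<close> is affine.
\<close>

lemma bubble_not_polyn:
  assumes r: "r \<ge> 1" and f: "f \<in> polyn (r + 1)"
    and eq: "\<And>y. y \<in> ref_square \<Longrightarrow> f (F y) = bubble r \<alpha> \<beta> y"
  shows "\<alpha> = 0 \<and> \<beta> = 0"
proof -
  define \<Delta> where "\<Delta> = A$1 * B$2 - B$1 * A$2"
  define l where "l = (C$1 * B$2 - B$1 * C$2) / \<Delta>"
  define m where "m = (A$1 * C$2 - C$1 * A$2) / \<Delta>"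
  have ref: "vector [u, v] \<in> ref_square" if "\<bar>u\<bar> \<le> 1" "\<bar>v\<bar> \<le> 1" for u v
    using that by (simp add: ref_square_def)
  have \<Delta>: "\<sigma> * \<Delta> > 0"
    using det_pos[OF ref[of 0 0]] by (simp add: bilin_det_def \<Delta>_def)
  then have \<Delta>0: "\<Delta> \<noteq> 0" by auto
  have J: "J y = \<Delta> * (1 + l * y$2 + m * y$1)" for y
    using \<Delta>0 by (simp add: l_def m_def bilin_det_def distrib_left) (simp add: \<Delta>_def algebra_simps)
  have pos: "1 + l * v + m * u > 0" if "\<bar>u\<bar> \<le> 1" "\<bar>v\<bar> \<le> 1" for u v
    using det_pos[OF ref[OF that]] \<Delta> by (simp add: J mult.assoc[symmetric] zero_less_mult_iff)
  have l: "\<bar>l\<bar> < 1" and m: "\<bar>m\<bar> < 1"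
    using pos[of 0 1] pos[of 0 "-1"] pos[of 1 0] pos[of "-1" 0] by auto
  have \<Delta>C: "\<Delta> * C$i = (C$1 * B$2 - B$1 * C$2) * A$i + (A$1 * C$2 - C$1 * A$2) * B$i" for i
    using exhaust_2[of i] by (auto simp: \<Delta>_def algebra_simps)
  have \<Delta>l: "\<Delta> * l = C$1 * B$2 - B$1 * C$2" "\<Delta> * m = A$1 * C$2 - C$1 * A$2"
    using \<Delta>0 by (simp_all add: l_def m_def)
  have "\<Delta> * C$i = \<Delta> * (l * A$i + m * B$i)" for i
    by (simp only: \<Delta>C distrib_left mult.assoc[symmetric] \<Delta>l)
  then have "C$i = l * A$i + m * B$i" for i
    using \<Delta>0 by (metis mult_left_cancel)
  then have C: "C = l *\<^sub>R A + m *\<^sub>R B" by (simp add: vec_eq_iff)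
  have F': "F (vector [u, v]) = p0 + (u * (1 + l * v)) *\<^sub>R A + (v * (1 + m * u)) *\<^sub>R B" for u v
    by (simp add: F C algebra_simps)
  have coord: "polynomial_function (\<lambda>y::real^2. y$i)" for i
    by (rule polynomial_function_bounded_linear) (rule bounded_linear_vec_nth)
  then have "polynomial_function (\<lambda>y::real^2. y$1 * y$2)"
    using polynomial_function_mult[OF coord[of 1] coord[of 2]] by simp
  then have "polynomial_function F"
    unfolding F by (intro polynomial_function_add polynomial_function_const polynomial_function_mult coord)
  then have "real_polynomial_function (\<lambda>y. f (F y) - bubble r \<alpha> \<beta> y)"
    using real_polynomial_function_compose[OF _ polyn_real_polynomial_function[OF f], of F]
      polyn_real_polynomial_function[OF bubble_polyn[OF r]]
    by (auto simp: o_def)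
  from real_polynomial_function_zero_of_open[OF this interior_ref_square]
  have "f (F y) = bubble r \<alpha> \<beta> y" for y using eq by fastforce
  then have everywhere: "f (p0 + (u * (1 + l * v)) *\<^sub>R A + (v * (1 + m * u)) *\<^sub>R B) = bub r \<alpha> \<beta> u v" for u v
    using F'[of u v] by (metis bubble_def vector_2)
  show ?thesis
  proof (cases "l = 0 \<and> m = 0")
    case False
    have "\<alpha> = 0 \<and> \<beta> = 0" if "l \<noteq> 0"
    proof (rule bub_collapse[OF that l])
      fix z
      show "bub r \<alpha> \<beta> z (- 1 / l) = bub r \<alpha> \<beta> 0 (- (1 + m * z) / l)"
      proof -
        have e: "z * (1 + l * (- 1 / l)) = 0 * (1 + l * (- (1 + m * z) / l))"
          "- 1 / l * (1 + m * z) = - (1 + m * z) / l * (1 + m * 0)"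
          using that by (simp, simp add: field_simps)
        show ?thesis unfolding everywhere[symmetric] unfolding e ..
      qed
    qed
    moreover have "\<beta> = 0 \<and> \<alpha> = 0" if "m \<noteq> 0"
    proof (rule bub_collapse[OF that m])
      fix z
      show "bub r \<beta> \<alpha> z (- 1 / m) = bub r \<beta> \<alpha> 0 (- (1 + l * z) / m)"
      proof -
        have e: "z * (1 + m * (- 1 / m)) = 0 * (1 + m * (- (1 + l * z) / m))"
          "- 1 / m * (1 + l * z) = - (1 + l * z) / m * (1 + l * 0)"
          using that by (simp, simp add: field_simps)
        show ?thesis unfolding bub_swap[of r \<beta> \<alpha>] everywhere[symmetric] unfolding e ..
      qed
    qed
    ultimately show ?thesis using False by blast
  next
    case True
    obtain n where n: "r = Suc n" using r by (cases r) auto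
    \<comment> \<open>Along the direction \<open>A + c B\<close> the coefficient of degree \<open>r + 2\<close> has to vanish.\<close>
    have top: "\<alpha> * c ^ (r + 1) + \<beta> * c = 0" for c :: real
    proof -
      obtain p where p: "degree p \<le> r + 1" "\<forall>t. f (p0 + t *\<^sub>R (A + c *\<^sub>R B)) = poly p t"
        using polyn_along_line[OF f] by metis
      let ?q = "monom (\<alpha> * c ^ n + \<beta> * c) r - monom (\<alpha> * c ^ (r + 1) + \<beta> * c) (r + 2)"
      have pt: "poly p t = bub r \<alpha> \<beta> t (t * c)" for t
        using everywhere[of t "t * c"] p(2) True by (simp add: scaleR_add_right add.assoc)
      have "poly p t = poly ?q t" for t
        unfolding pt by (simp add: bub_def n poly_monom algebra_simps power2_eq_square power_mult_distrib)
      then have "p = ?q" using poly_eq_poly_eq_iff by blast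
      then have "coeff p (r + 2) = - (\<alpha> * c ^ (r + 1) + \<beta> * c)" by simp
      then show ?thesis using p(1) by (simp add: coeff_eq_0)
    qed
    have "\<alpha> + \<beta> = 0" using top[of 1] by simp
    then have \<beta>: "\<beta> = - \<alpha>" by simp
    have "2 * (\<alpha> * (2 ^ r - 1)) = \<alpha> * 2 ^ (r + 1) + \<beta> * 2" unfolding \<beta> by (simp add: algebra_simps)
    then have "\<alpha> * (2 ^ r - 1) = 0" using top[of 2] by simp
    moreover have "1 < (2::real) ^ r" by (rule one_less_power) (use n in simp_all)
    ultimately show ?thesis using \<open>\<alpha> + \<beta> = 0\<close> by simp
  qed
qed

end

section \<open>Exactness\<close>

text \<open>
  The components are given as a pair so that spaces of polynomial fields can be handled as sets of
  pairs of polynomials on the whole plane.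
\<close>

definition vfield :: "(real^2) set \<Rightarrow> (real^2 \<Rightarrow> real) \<times> (real^2 \<Rightarrow> real) \<Rightarrow> real^2 \<Rightarrow> real^2" where
  "vfield E P = on_set E (\<lambda>x. vector [fst P x, snd P x])"

lemma vec_poly_space_eq: "vec_poly_space k E = vfield E ` (polyn k \<times> polyn k)"
proof (intro equalityI subsetI)
  fix \<psi> assume "\<psi> \<in> vec_poly_space k E"
  then obtain p q where "p \<in> polyn k" "q \<in> polyn k" "(\<lambda>x. \<psi> x $ 1) = on_set E p" "(\<lambda>x. \<psi> x $ 2) = on_set E q"
    by (auto simp: vec_poly_space_def poly_space_eq)
  moreover from this have "\<psi> = vfield E (p, q)"
    by (auto simp: vfield_def fun_eq_iff vector_2_eq_iff on_set_def)
  ultimately show "\<psi> \<in> vfield E ` (polyn k \<times> polyn k)" by blast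
next
  fix \<psi> assume "\<psi> \<in> vfield E ` (polyn k \<times> polyn k)"
  then obtain p q where pq: "p \<in> polyn k" "q \<in> polyn k" "\<psi> = vfield E (p, q)" by auto
  have "(\<lambda>x. \<psi> x $ 1) = on_set E p" "(\<lambda>x. \<psi> x $ 2) = on_set E q"
    by (auto simp: pq vfield_def on_set_def)
  then show "\<psi> \<in> vec_poly_space k E" using pq by (auto simp: vec_poly_space_def poly_space_eq)
qed

lemma bex_fun_sum: "(\<exists>h\<in>fun_sum V W. P h) \<longleftrightarrow> (\<exists>f\<in>V. \<exists>g\<in>W. P (\<lambda>x. f x + g x))"
  by (auto simp: fun_sum_def)

lemma in_fun_sum: "h \<in> fun_sum V W \<longleftrightarrow> (\<exists>f\<in>V. \<exists>g\<in>W. h = (\<lambda>x. f x + g x))"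
  by (auto simp: fun_sum_def)

lemma position_times_eq: "position_times V = (\<lambda>q x. q x *\<^sub>R x) ` V"
  by (auto simp: position_times_def)

context bilinear_chart begin

lemma DS_map_iff:
  "\<phi> \<in> DS_map r F E \<longleftrightarrow> (\<exists>f\<in>polyn (r + 1). \<exists>s\<in>DS_suppl r F E. \<phi> = (\<lambda>x. on_set E f x + s x))"
  by (auto simp: DS_map_def fun_sum_def poly_space_eq)

lemma zero_DS_suppl: "(\<lambda>x. 0) \<in> DS_suppl r F E"
  unfolding DS_suppl_def fun_span2_def by (intro CollectI exI[of _ 0]) simp

lemma curl_add_DS_suppl:
  assumes f: "f \<in> polyn k" and s: "s \<in> DS_suppl r F E" and r: "r \<ge> 1"
  shows "(\<lambda>x. on_set E f x + s x) differentiable_on E"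
    and "curl_on E (\<lambda>x. on_set E f x + s x) = (\<lambda>x. vfield E (pd 2 f, \<lambda>x. - pd 1 f x) x + curl_on E s x)"
    and "curl_on E (\<lambda>x. on_set E f x + s x) = (\<lambda>x. 0) \<Longrightarrow> \<exists>c. (\<lambda>x. on_set E f x + s x) = const_on E c"
proof -
  obtain s1 s2 where s': "has_partials E s s1 s2" using DS_suppl_has_partials[OF s r] .
  note part = has_partials_add[OF has_partials_on_set[OF has_partials_polyn[OF f]] s']
  show "(\<lambda>x. on_set E f x + s x) differentiable_on E" by (rule has_partials_differentiable_on[OF part])
  show "curl_on E (\<lambda>x. on_set E f x + s x) = (\<lambda>x. vfield E (pd 2 f, \<lambda>x. - pd 1 f x) x + curl_on E s x)"
    unfolding curl_on_eq[OF part] curl_on_eq[OF s']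
    by (auto simp: vfield_def on_set_def fun_eq_iff vector_2_eq_iff)
  assume "curl_on E (\<lambda>x. on_set E f x + s x) = (\<lambda>x. 0)"
  then obtain c where "\<And>x. x \<in> E \<Longrightarrow> on_set E f x + s x = 0 + c"
    using equal_curl_differ_by_constant[OF part, of "\<lambda>x. 0" "\<lambda>x. 0" "\<lambda>x. 0"] curl_zero
    by (auto simp: has_partials_def)
  moreover have "s x = 0" if "x \<notin> E" for x using s that by (auto simp: DS_suppl_eq pull0_def on_set_def)
  ultimately show "\<exists>c. (\<lambda>x. on_set E f x + s x) = const_on E c"
    by (intro exI[of _ c]) (auto simp: const_on_def fun_eq_iff on_set_def)
qed

lemma div_add_curl_DS_suppl:
  assumes p: "p \<in> polyn k" and q: "q \<in> polyn l" and s: "s \<in> DS_suppl r F E" and r: "r \<ge> 1"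
  shows "(\<lambda>x. vfield E (p, q) x + curl_on E s x) differentiable_on E"
    and "div_on E (\<lambda>x. vfield E (p, q) x + curl_on E s x) = on_set E (\<lambda>x. pd 1 p x + pd 2 q x)"
proof -
  obtain p1 p2 q1 q2 where c: "has_partials E (\<lambda>x. curl_on E s x $ 1) p1 p2"
    "has_partials E (\<lambda>x. curl_on E s x $ 2) q1 q2" "\<forall>x\<in>E. p1 x + q2 x = 0"
    using DS_suppl_curl_has_partials[OF s r] .
  have v: "(\<lambda>x. vfield E (p, q) x $ 1) = on_set E p" "(\<lambda>x. vfield E (p, q) x $ 2) = on_set E q"
    by (auto simp: vfield_def on_set_def)
  have P: "has_partials E (\<lambda>x. (vfield E (p, q) x + curl_on E s x) $ 1) (\<lambda>x. pd 1 p x + p1 x) (\<lambda>x. pd 2 p x + p2 x)"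
    using has_partials_add[OF has_partials_on_set[OF has_partials_polyn[OF p]] c(1)] by (simp flip: v)
  have Q: "has_partials E (\<lambda>x. (vfield E (p, q) x + curl_on E s x) $ 2) (\<lambda>x. pd 1 q x + q1 x) (\<lambda>x. pd 2 q x + q2 x)"
    using has_partials_add[OF has_partials_on_set[OF has_partials_polyn[OF q]] c(2)] by (simp flip: v)
  show "(\<lambda>x. vfield E (p, q) x + curl_on E s x) differentiable_on E"
    by (rule vec2_differentiable_on[OF P Q])
  show "div_on E (\<lambda>x. vfield E (p, q) x + curl_on E s x) = on_set E (\<lambda>x. pd 1 p x + pd 2 q x)"
    unfolding div_on_eq[OF P Q] using c(3) by (intro on_set_cong) (auto simp: algebra_simps)
qed

text \<open>
  The two spaces of fields have the form \<open>P + curl S\<close>, where \<open>S\<close> is the serendipity supplement.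
  Elements of \<open>S\<close> are carried along unchanged by the curl and are annihilated by the divergence of the
  curl, so only conditions on the polynomial fields \<open>P\<close> remain.
\<close>

lemma exact_curl_div_polynomial_part:
  assumes r: "r \<ge> 1"
    and P: "P \<subseteq> polyn m \<times> polyn m"
    and W: "W = fun_sum (vfield E ` P) (curl_on E ` DS_suppl r F E)"
    and curl: "\<And>f. f \<in> polyn (r + 1) \<Longrightarrow> (pd 2 f, \<lambda>x. - pd 1 f x) \<in> P"
    and div: "(\<lambda>(p, q) x. pd 1 p x + pd 2 q x) ` P = polyn l"
    and kernel: "\<And>p q. (p, q) \<in> P \<Longrightarrow> (\<lambda>x. pd 1 p x + pd 2 q x) = (\<lambda>x. 0) \<Longrightarrow>
        \<exists>f\<in>polyn (r + 1). pd 2 f = p \<and> pd 1 f = (\<lambda>x. - q x)"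
  shows "exact_curl_div E (DS_map r F E) W (poly_space l E)"
proof -
  have const: "const_on E t = (\<lambda>x. on_set E (\<lambda>x. t) x + 0)" for t
    by (simp add: const_on_def)
  have const_DS: "const_on E t \<in> DS_map r F E" for t
    unfolding DS_map_iff using const[of t] zero_DS_suppl[of r] polyn_const[of t "r + 1"]
    by (intro bexI[of _ "\<lambda>x. t"] bexI[of _ "\<lambda>x. 0"])
  have W_div: "div_on E (\<lambda>x. vfield E v x + curl_on E s x) = on_set E ((\<lambda>(p, q) x. pd 1 p x + pd 2 q x) v)"
    "(\<lambda>x. vfield E v x + curl_on E s x) differentiable_on E" 
    if "v \<in> P" "s \<in> DS_suppl r F E" for v s
    using that P div_add_curl_DS_suppl[of "fst v" m "snd v" m s r] r
    by (auto simp: case_prod_unfold)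
  have V_curl: "curl_on E ` DS_map r F E = {\<psi> \<in> W. div_on E \<psi> = (\<lambda>x. 0)}"
  proof (intro equalityI subsetI)
    fix \<psi> assume "\<psi> \<in> curl_on E ` DS_map r F E"
    then obtain f s where f: "f \<in> polyn (r + 1)" and s: "s \<in> DS_suppl r F E" 
      and \<psi>: "\<psi> = (\<lambda>x. vfield E (pd 2 f, \<lambda>x. - pd 1 f x) x + curl_on E s x)"
      using curl_add_DS_suppl(2)[OF _ _ r] by (auto simp: DS_map_iff)
    have "pd 2 (\<lambda>x. - pd 1 f x) = (\<lambda>x. - pd 2 (pd 1 f) x)"
      using pd_cmul[OF polyn_pd[OF f], of 2 "-1" 1] by simp
    then have "div_on E \<psi> = (\<lambda>x. 0)"
      unfolding \<psi> W_div(1)[OF curl[OF f] s] by (auto simp: pd_commute[OF f] on_set_def)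
    moreover have "\<psi> \<in> W"
      unfolding \<psi> W in_fun_sum using curl[OF f] s by blast
    ultimately show "\<psi> \<in> {\<psi> \<in> W. div_on E \<psi> = (\<lambda>x. 0)}" by simp
  next
    fix \<psi> assume "\<psi> \<in> {\<psi> \<in> W. div_on E \<psi> = (\<lambda>x. 0)}"
    then obtain p q s where pq: "(p, q) \<in> P" and s: "s \<in> DS_suppl r F E" 
      and \<psi>: "\<psi> = (\<lambda>x. vfield E (p, q) x + curl_on E s x)" and "div_on E \<psi> = (\<lambda>x. 0)"
      by (auto simp: W in_fun_sum)
    then have "on_set E (\<lambda>x. pd 1 p x + pd 2 q x) = on_set E (\<lambda>x. 0)"
      using W_div(1)[OF pq s] by (simp add: on_set_def)
    moreover have "(\<lambda>x. pd 1 p x + pd 2 q x) \<in> polyn l" using div pq by force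
    ultimately have "(\<lambda>x. pd 1 p x + pd 2 q x) = (\<lambda>x. 0)"
      using polyn_eq_on_open[OF _ polyn_const interior] by blast
    then obtain f where f: "f \<in> polyn (r + 1)" "pd 2 f = p" "pd 1 f = (\<lambda>x. - q x)"
      using kernel[OF pq] by blast
    then have "\<psi> = curl_on E (\<lambda>x. on_set E f x + s x)"
      by (simp add: \<psi> curl_add_DS_suppl(2)[OF f(1) s r])
    moreover have "(\<lambda>x. on_set E f x + s x) \<in> DS_map r F E" 
      unfolding DS_map_iff using f(1) s by blast
    ultimately show "\<psi> \<in> curl_on E ` DS_map r F E" by blast
  qed
  have W_image: "div_on E ` W = poly_space l E"
  proof -
    have "g \<in> div_on E ` W \<longleftrightarrow> g \<in> on_set E ` ((\<lambda>(p, q) x. pd 1 p x + pd 2 q x) ` P)" for g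
    proof -
      have "g \<in> div_on E ` W \<longleftrightarrow>
          (\<exists>v\<in>P. \<exists>s\<in>DS_suppl r F E. g = div_on E (\<lambda>x. vfield E v x + curl_on E s x))"
        by (simp add: image_iff[of g] W bex_fun_sum)
      also have "\<dots> \<longleftrightarrow> (\<exists>v\<in>P. \<exists>s\<in>DS_suppl r F E. g = on_set E ((\<lambda>(p, q) x. pd 1 p x + pd 2 q x) v))"
        by (intro bex_cong refl) (simp add: W_div(1))
      also have "\<dots> \<longleftrightarrow> g \<in> on_set E ` ((\<lambda>(p, q) x. pd 1 p x + pd 2 q x) ` P)"
        using zero_DS_suppl[of r] by blast
      finally show ?thesis .
    qed
    then show ?thesis unfolding div poly_space_eq by blast
  qed
  have "inj (const_on E)"
    using nonempty by (auto intro!: injI simp: const_on_def on_set_eq_iff)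
  moreover have "\<forall>\<phi>\<in>DS_map r F E. \<phi> differentiable_on E"
    using curl_add_DS_suppl(1)[OF _ _ r] by (auto simp: DS_map_iff)
  moreover have "\<forall>\<psi>\<in>W. \<psi> differentiable_on E" using W_div(2) by (auto simp: W in_fun_sum)
  moreover have "range (const_on E) = {\<phi> \<in> DS_map r F E. curl_on E \<phi> = (\<lambda>x. 0)}"
  proof (intro equalityI subsetI)
    fix \<phi> assume "\<phi> \<in> {\<phi> \<in> DS_map r F E. curl_on E \<phi> = (\<lambda>x. 0)}"
    then obtain f s where f: "f \<in> polyn (r + 1)" and s: "s \<in> DS_suppl r F E"
      and \<phi>: "\<phi> = (\<lambda>x. on_set E f x + s x)" and "curl_on E \<phi> = (\<lambda>x. 0)"
      by (auto simp: DS_map_iff)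
    then show "\<phi> \<in> range (const_on E)"
      using curl_add_DS_suppl(3)[OF f s r] by (metis rangeI)
  qed (use const_DS curl_const in auto)
  ultimately show ?thesis
    unfolding exact_curl_div_def using V_curl W_image const_DS by auto
qed

lemma AC_red_eq:
  assumes "r \<ge> 1"
  shows "AC_red r F E = fun_sum (vfield E ` (polyn r \<times> polyn r)) (curl_on E ` DS_suppl r F E)"
  unfolding AC_red_def vec_poly_space_eq AC_suppl_eq[OF assms] ..

lemma exact_AC_red:
  assumes r: "r \<ge> 1"
  shows "exact_curl_div E (DS_map r F E) (AC_red r F E) (poly_space (r - 1) E)"
proof (rule exact_curl_div_polynomial_part[OF r order_refl AC_red_eq[OF r]])
  fix f assume "f \<in> polyn (r + 1)"
  then have "pd i f \<in> polyn r" for i using polyn_pd[of f "r + 1" i] by simp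
  then show "(pd 2 f, \<lambda>x. - pd 1 f x) \<in> polyn r \<times> polyn r" by (auto intro: polyn_minus)
next
  show "(\<lambda>(p, q) x. pd 1 p x + pd 2 q x) ` (polyn r \<times> polyn r) = polyn (r - 1)"
  proof (intro equalityI subsetI)
    fix g assume "g \<in> polyn (r - 1)"
    then obtain p where "p \<in> polyn r" "pd 1 p = g"
      using polyn_antiderivative[of g "r - 1" 1] r by auto
    moreover have "pd 2 (\<lambda>x. 0) = (\<lambda>x. 0)" using pd_monom(2)[of 0 0 0] by simp
    ultimately show "g \<in> (\<lambda>(p, q) x. pd 1 p x + pd 2 q x) ` (polyn r \<times> polyn r)"
      by (intro image_eqI[of _ _ "(p, \<lambda>x. 0)"]) (auto intro: polyn_const)
  qed (auto simp del: One_nat_def intro!: polyn_add polyn_pd)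
next
  fix p q assume "(p, q) \<in> polyn r \<times> polyn r" "(\<lambda>x. pd 1 p x + pd 2 q x) = (\<lambda>x. 0)"
  then show "\<exists>f\<in>polyn (r + 1). pd 2 f = p \<and> pd 1 f = (\<lambda>x. - q x)"
    using polyn_curl_potential[of p r q] by (auto simp: fun_eq_iff)
qed

text \<open>
  Adding \<open>x h\<close> to a polynomial field gives a polynomial field again, so the full space has the same
  form \<open>P + curl S\<close> as the reduced one.
\<close>

definition radial_shift ::
  "((real^2 \<Rightarrow> real) \<times> (real^2 \<Rightarrow> real)) \<Rightarrow> (real^2 \<Rightarrow> real) \<Rightarrow> (real^2 \<Rightarrow> real) \<times> (real^2 \<Rightarrow> real)" where
  "radial_shift v h = ((\<lambda>x. fst v x + x$1 * h x), (\<lambda>x. snd v x + x$2 * h x))"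

lemma div_radial_shift:
  assumes "p \<in> polyn r" "q \<in> polyn r" "h \<in> homog r"
  shows "pd 1 (fst (radial_shift (p, q) h)) x + pd 2 (snd (radial_shift (p, q) h)) x
    = pd 1 p x + pd 2 q x + real (r + 2) * h x"
  using div_position_homog(2)[OF assms(3), of x]
  by (simp add: radial_shift_def pd_add[OF assms(1) div_position_homog(1)[OF assms(3)]]
      pd_add[OF assms(2) div_position_homog(1)[OF assms(3)]])

lemma AC_full_eq:
  assumes "r \<ge> 1"
  shows "AC_full r F E = 
    fun_sum (vfield E ` {radial_shift v h |v h. v \<in> polyn r \<times> polyn r \<and> h \<in> homog r}) (curl_on E ` DS_suppl r F E)"
proof -
  have *: "(\<lambda>x. (vfield E v x + curl_on E s x) + on_set E h x *\<^sub>R x)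
    = (\<lambda>x. vfield E (radial_shift v h) x + curl_on E s x)" for v s h
    by (auto simp: vfield_def on_set_def radial_shift_def fun_eq_iff vector_2_eq_iff)
  show ?thesis
  proof (rule set_eqI)
    fix \<psi>
    have "\<psi> \<in> AC_full r F E \<longleftrightarrow> (\<exists>v\<in>polyn r \<times> polyn r. \<exists>s\<in>DS_suppl r F E. \<exists>h\<in>homog r.
        \<psi> = (\<lambda>x. vfield E (radial_shift v h) x + curl_on E s x))"
      unfolding AC_full_def AC_red_eq[OF assms] position_times_eq hom_poly_space_eq
        in_fun_sum bex_fun_sum bex_simps *[symmetric] ..
    also have "\<dots> \<longleftrightarrow> \<psi> \<in> fun_sum (vfield E ` {radial_shift v h |v h. v \<in> polyn r \<times> polyn r \<and> h \<in> homog r})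
        (curl_on E ` DS_suppl r F E)"
      unfolding in_fun_sum by blast
    finally show "\<psi> \<in> AC_full r F E \<longleftrightarrow>
      \<psi> \<in> fun_sum (vfield E ` {radial_shift v h |v h. v \<in> polyn r \<times> polyn r \<and> h \<in> homog r}) (curl_on E ` DS_suppl r F E)" .
  qed
qed

text \<open>
  In a field with vanishing divergence the homogeneous part \<open>h\<close> of degree \<open>r\<close> is, up to the factor
  \<open>- 1 / (r + 2)\<close>, the divergence of a field of degree \<open>r\<close>, hence of degree less than \<open>r\<close>, hence zero.
\<close>

lemma exact_AC_full:
  assumes r: "r \<ge> 1"
  shows "exact_curl_div E (DS_map r F E) (AC_full r F E) (poly_space r E)"
proof (rule exact_curl_div_polynomial_part[OF r _ AC_full_eq[OF r]])
  have "f \<in> polyn (Suc r)" if "f \<in> polyn r" for f using polyn_mono[OF that] by simp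
  then show "{radial_shift v h |v h. v \<in> polyn r \<times> polyn r \<and> h \<in> homog r} \<subseteq> polyn (Suc r) \<times> polyn (Suc r)"
    by (auto simp: radial_shift_def intro!: polyn_add div_position_homog(1))
next
  fix f assume "f \<in> polyn (r + 1)"
  then have *: "pd i f \<in> polyn r" for i using polyn_pd[of f "r + 1" i] by simp
  have "(pd 2 f, \<lambda>x. - pd 1 f x) = radial_shift (pd 2 f, \<lambda>x. - pd 1 f x) (\<lambda>x. 0)"
    by (simp add: radial_shift_def)
  then show "(pd 2 f, \<lambda>x. - pd 1 f x) \<in> {radial_shift v h |v h. v \<in> polyn r \<times> polyn r \<and> h \<in> homog r}"
    using *[of 2] polyn_minus[OF *[of 1]] homog_zero[of r] by force
next
  obtain n where n: "r = Suc n" using r by (cases r) auto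
  show "(\<lambda>(p, q) x. pd 1 p x + pd 2 q x) ` ({radial_shift v h |v h. v \<in> polyn r \<times> polyn r \<and> h \<in> homog r}) = polyn r"
  proof (intro equalityI subsetI)
    fix g assume "g \<in> (\<lambda>(p, q) x. pd 1 p x + pd 2 q x) ` ({radial_shift v h |v h. v \<in> polyn r \<times> polyn r \<and> h \<in> homog r})"
    then obtain p q h where pq: "p \<in> polyn r" "q \<in> polyn r" "h \<in> homog r"
      and g: "g = (\<lambda>x. pd 1 p x + pd 2 q x + real (r + 2) * h x)"
      by (auto simp: case_prod_unfold div_radial_shift)
    have "pd 1 p \<in> polyn r" "pd 2 q \<in> polyn r"
      using polyn_mono[OF polyn_pd[OF pq(1)], of r] polyn_mono[OF polyn_pd[OF pq(2)], of r] by simp_all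
    then show "g \<in> polyn r" unfolding g using homog_polyn[OF pq(3)] by (intro polyn_add polyn_cmul)
  next
    fix g assume "g \<in> polyn r"
    then obtain f h where f: "f \<in> polyn n" and h: "h \<in> homog r" and g: "g = (\<lambda>x. f x + h x)"
      using polyn_split_homog[of g n] n by blast
    obtain p where p: "p \<in> polyn r" "pd 1 p = f" using polyn_antiderivative[OF f] n by blast
    define h' where "h' = (\<lambda>x. (1 / real (r + 2)) * h x)"
    have h': "h' \<in> homog r"
    proof -
      obtain c where "h = (\<lambda>x. \<Sum>i\<le>r. c i * (x$1) ^ i * (x$2) ^ (r - i))"
        using h by (auto simp: homog_def)
      then show ?thesis unfolding h'_def homog_def
        by (intro CollectI exI[of _ "\<lambda>i. (1 / real (r + 2)) * c i"]) (simp add: sum_distrib_left mult.assoc)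
    qed
    have "pd 2 (\<lambda>x. 0) = (\<lambda>x. 0)" using pd_monom(2)[of 0 0 0] by simp
    then have "g = (\<lambda>(p, q) x. pd 1 p x + pd 2 q x) (radial_shift (p, \<lambda>x. 0) h')"
      using div_radial_shift[OF p(1) polyn_const h', of 0] p
      by (auto simp: case_prod_unfold g h'_def fun_eq_iff)
    then show "g \<in> (\<lambda>(p, q) x. pd 1 p x + pd 2 q x) ` ({radial_shift v h |v h. v \<in> polyn r \<times> polyn r \<and> h \<in> homog r})"
      using p h' polyn_const[of 0 r] by (intro image_eqI[of g _ "radial_shift (p, \<lambda>x. 0) h'"]) (force simp: image_iff)+
  qed
next
  fix p' q' assume pq': "(p', q') \<in> {radial_shift v h |v h. v \<in> polyn r \<times> polyn r \<and> h \<in> homog r}" 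
    and div: "(\<lambda>x. pd 1 p' x + pd 2 q' x) = (\<lambda>x. 0)"
  then obtain p q h where pq: "p \<in> polyn r" "q \<in> polyn r" and h: "h \<in> homog r"
    and eq: "(p', q') = radial_shift (p, q) h" by auto
  have sum0: "pd 1 p x + pd 2 q x + real (r + 2) * h x = 0" for x
    using div_radial_shift[OF pq h, of x] fun_cong[OF div, of x] by (simp flip: eq)
  then have "h = (\<lambda>x. (- 1 / real (r + 2)) * (pd 1 p x + pd 2 q x))"
    by (auto simp: fun_eq_iff field_simps) (smt (verit))
  also have "\<dots> \<in> polyn (r - 1)" using pq by (intro polyn_cmul polyn_add polyn_pd)
  finally have "h \<in> polyn (r - 1)" .
  then have h0: "h x = 0" for x using homog_polyn_zero[OF h] r by simp
  then have "p' = p" "q' = q" using eq by (auto simp: radial_shift_def)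
  then show "\<exists>f\<in>polyn (r + 1). pd 2 f = p' \<and> pd 1 f = (\<lambda>x. - q' x)"
    using polyn_curl_potential[OF pq] sum0 h0 by auto
qed


lemma DS_suppl_polyn_zero:
  assumes r: "r \<ge> 1" and s: "s \<in> DS_suppl r F E" and f: "f \<in> polyn (r + 1)"
    and eq: "\<And>x. x \<in> E \<Longrightarrow> s x = f x"
  shows "s = (\<lambda>x. 0)"
proof -
  obtain \<alpha> \<beta> where s: "s = pull0 F E (bubble r \<alpha> \<beta>)" using s by (auto simp: DS_suppl_eq)
  have "f (F y) = bubble r \<alpha> \<beta> y" if "y \<in> ref_square" for y
  proof -
    have "F y \<in> E" using that image by blast
    then show ?thesis using eq[of "F y"] G_F[OF that] by (simp add: s pull0_def on_set_def G_def)
  qed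
  then have "\<alpha> = 0 \<and> \<beta> = 0" by (rule bubble_not_polyn[OF r f])
  then show ?thesis by (auto simp: s pull0_def on_set_def bubble_eq)
qed

lemma direct_DS_map:
  assumes "r \<ge> 1" shows "sum_is_direct (poly_space (r + 1) E) (DS_suppl r F E)"
proof -
  have "(\<lambda>x. 0) \<in> poly_space (r + 1) E"
    unfolding poly_space_eq by (rule image_eqI[OF _ polyn_const[of 0]]) (simp add: on_set_def fun_eq_iff)
  moreover have "s = (\<lambda>x. 0)" if "s \<in> poly_space (r + 1) E" "s \<in> DS_suppl r F E" for s
    using that DS_suppl_polyn_zero[OF assms that(2)] by (auto simp: poly_space_eq on_set_apply)
  ultimately show ?thesis using zero_DS_suppl unfolding sum_is_direct_def by blast
qed

lemma vfield_zero: "vfield E (\<lambda>x. 0, \<lambda>x. 0) = (\<lambda>x. 0)"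
  by (auto simp: vfield_def on_set_def vector_2_eq_iff)

lemma zero_in_curl_DS_suppl: "(\<lambda>x. 0) \<in> curl_on E ` DS_suppl r F E"
proof -
  have "curl_on E (\<lambda>x. 0) \<in> curl_on E ` DS_suppl r F E"
    by (rule imageI) (rule zero_DS_suppl)
  then show ?thesis by (simp only: curl_zero)
qed

lemma zero_in_vfield: "(\<lambda>x. 0) \<in> vfield E ` (polyn k \<times> polyn k)"
proof -
  have "vfield E (\<lambda>x. 0, \<lambda>x. 0) \<in> vfield E ` (polyn k \<times> polyn k)"
    by (rule imageI) (simp add: polyn_const)
  then show ?thesis by (simp only: vfield_zero)
qed

lemma div_vfield:
  assumes "p \<in> polyn k" "q \<in> polyn l" "(r::nat) \<ge> 1"
  shows "div_on E (vfield E (p, q)) = on_set E (\<lambda>x. pd 1 p x + pd 2 q x)"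
  using div_add_curl_DS_suppl(2)[OF assms(1,2) zero_DS_suppl assms(3)] by (simp add: curl_zero)

lemma div_curl_DS_suppl:
  assumes "s \<in> DS_suppl r F E" "r \<ge> 1"
  shows "div_on E (curl_on E s) = (\<lambda>x. 0)"
proof -
  have "pd i (\<lambda>x. 0) = (\<lambda>x. 0)" for i using pd_cmul[OF polyn_const, of i 0 0] by simp
  then show ?thesis
    using div_add_curl_DS_suppl(2)[OF polyn_const polyn_const assms, of 0 0]
    by (simp add: vfield_zero on_set_def)
qed

text \<open>
  A field in the intersection is the curl of some \<open>s\<close> in the serendipity supplement and, being
  divergence free and polynomial, the curl of a polynomial.  Then \<open>s\<close> is itself a polynomial of degree
  \<open>r + 1\<close> up to a constant, so \<open>s = 0\<close>.
\<close>

lemma direct_AC_red: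
  assumes r: "r \<ge> 1" shows "sum_is_direct (vec_poly_space r E) (AC_suppl r F E)"
proof -
  have "\<psi> = (\<lambda>x. 0)" if vec: "\<psi> \<in> vec_poly_space r E" and suppl: "\<psi> \<in> AC_suppl r F E" for \<psi>
  proof -
    obtain p q where pq: "p \<in> polyn r" "q \<in> polyn r" "\<psi> = vfield E (p, q)"
      using vec by (auto simp: vec_poly_space_eq)
    obtain s where s: "s \<in> DS_suppl r F E" "\<psi> = curl_on E s"
      using suppl by (auto simp: AC_suppl_eq[OF r])
    have "on_set E (\<lambda>x. pd 1 p x + pd 2 q x) = on_set E (\<lambda>x. 0)"
      using div_curl_DS_suppl[OF s(1) r] div_vfield[OF pq(1,2) r] pq(3) s(2) by (simp add: on_set_def)
    then have "(\<lambda>x. pd 1 p x + pd 2 q x) = (\<lambda>x. 0)"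
      using polyn_eq_on_open[OF polyn_add[OF polyn_pd[OF pq(1)] polyn_pd[OF pq(2)]] polyn_const interior]
      by blast
    then obtain f where f: "f \<in> polyn (Suc r)" "pd 2 f = p" "pd 1 f = (\<lambda>x. - q x)"
      using polyn_curl_potential[OF pq(1,2)] by (metis (no_types, lifting))
    obtain s1 s2 where s': "has_partials E s s1 s2" using DS_suppl_has_partials[OF s(1) r] .
    have "curl_on E s = curl_on E f"
      using curl_on_eq[OF has_partials_polyn[OF f(1)]] pq(3) s(2) by (simp add: f(2,3) vfield_def)
    then obtain c where "\<And>x. x \<in> E \<Longrightarrow> s x = f x + c"
      using equal_curl_differ_by_constant[OF s' has_partials_polyn[OF f(1)]] by blast
    moreover have "(\<lambda>x. f x + c) \<in> polyn (r + 1)" using polyn_add[OF f(1) polyn_const] by simp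
    ultimately have "s = (\<lambda>x. 0)" using DS_suppl_polyn_zero[OF r s(1)] by blast
    then show ?thesis by (simp add: s(2) curl_zero)
  qed
  moreover have "(\<lambda>x. 0) \<in> vec_poly_space r E"
    unfolding vec_poly_space_eq by (rule zero_in_vfield)
  moreover have "(\<lambda>x. 0) \<in> AC_suppl r F E"
    unfolding AC_suppl_eq[OF r] by (rule zero_in_curl_DS_suppl)
  ultimately show ?thesis unfolding sum_is_direct_def by blast
qed

text \<open>
  The divergence of a field in the intersection has degree less than \<open>r\<close> and equals \<open>(r + 2) h\<close> with
  \<open>h\<close> homogeneous of degree \<open>r\<close>.
\<close>

lemma direct_AC_full:
  assumes r: "r \<ge> 1" shows "sum_is_direct (AC_red r F E) (position_times (hom_poly_space r E))"
proof -
  have "\<psi> = (\<lambda>x. 0)" if red: "\<psi> \<in> AC_red r F E" and pos: "\<psi> \<in> position_times (hom_poly_space r E)" for \<psi>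
  proof -
    obtain p q s where pq: "p \<in> polyn r" "q \<in> polyn r" and s: "s \<in> DS_suppl r F E"
      and 1: "\<psi> = (\<lambda>x. vfield E (p, q) x + curl_on E s x)"
      using red by (auto simp: AC_red_eq[OF r] in_fun_sum)
    obtain h where h: "h \<in> homog r" and \<psi>: "\<psi> = (\<lambda>x. on_set E h x *\<^sub>R x)"
      using pos by (auto simp: position_times_eq hom_poly_space_eq)
    have 2: "\<psi> = vfield E (\<lambda>x. x$1 * h x, \<lambda>x. x$2 * h x)"
      by (auto simp: \<psi> vfield_def on_set_def vector_2_eq_iff)
    have "on_set E (\<lambda>x. pd 1 p x + pd 2 q x) = on_set E (\<lambda>x. real (r + 2) * h x)"
      using div_add_curl_DS_suppl(2)[OF pq s r] 1
        div_vfield[OF div_position_homog(1)[OF h, of 1] div_position_homog(1)[OF h, of 2] r] 2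
        div_position_homog(2)[OF h] by simp
    then have "(\<lambda>x. pd 1 p x + pd 2 q x) = (\<lambda>x. real (r + 2) * h x)"
      by (rule polyn_eq_on_open[OF polyn_add[OF polyn_pd[OF pq(1)] polyn_pd[OF pq(2)]]
        polyn_cmul[OF homog_polyn[OF h]] interior])
    then have eq: "real (r + 2) * h x = pd 1 p x + pd 2 q x" for x by (rule fun_cong[symmetric])
    then have "h = (\<lambda>x. (1 / real (r + 2)) * (pd 1 p x + pd 2 q x))"
      by (simp flip: eq)
    also have "\<dots> \<in> polyn (r - 1)" using pq by (intro polyn_cmul polyn_add polyn_pd)
    finally have "h x = 0" for x using homog_polyn_zero[OF h] r by simp
    then show ?thesis by (auto simp: \<psi> on_set_def fun_eq_iff)
  qed
  moreover have "(\<lambda>x. 0) \<in> AC_red r F E"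
    unfolding AC_red_eq[OF r] in_fun_sum
    by (intro bexI[OF _ zero_in_vfield] bexI[OF _ zero_in_curl_DS_suppl]) simp
  moreover have "(\<lambda>x. 0) \<in> position_times (hom_poly_space r E)"
    unfolding position_times_eq hom_poly_space_eq
    by (intro image_eqI[of _ _ "on_set E (\<lambda>x. 0)"] imageI homog_zero) (simp add: on_set_def fun_eq_iff)
  ultimately show ?thesis unfolding sum_is_direct_def by blast
qed

end

section \<open>Convex quadrilaterals\<close>

text \<open>
  Twice the signed area of the triangle \<open>p q x\<close>.
\<close>

definition orient :: "real^2 \<Rightarrow> real^2 \<Rightarrow> real^2 \<Rightarrow> real" where
  "orient p q x = (q$1 - p$1) * (x$2 - p$2) - (q$2 - p$2) * (x$1 - p$1)"

lemma orient_rotate: "orient p q x = orient q x p"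
  by (simp add: orient_def algebra_simps)

lemma orient_self [simp]: "orient p q p = 0" "orient p q q = 0"
  by (simp_all add: orient_def)

lemma orient_affine:
  assumes "u + v = 1"
  shows "orient p q (u *\<^sub>R x + v *\<^sub>R y) = u * orient p q x + v * orient p q y"
proof -
  from assms have "v = 1 - u" by simp
  show ?thesis unfolding \<open>v = 1 - u\<close> by (simp add: orient_def algebra_simps)
qed

lemma orient_zero_on_line:
  assumes "p \<noteq> q" "orient p q x = 0"
  obtains t where "x = (1 - t) *\<^sub>R p + t *\<^sub>R q"
proof (cases "p$1 = q$1")
  case True
  then have "p$2 \<noteq> q$2" using assms(1) by (simp add: vector_2_eq_iff)
  define t where "t = (x$2 - p$2) / (q$2 - p$2)"
  have "t * (q$2 - p$2) = x$2 - p$2" using \<open>p$2 \<noteq> q$2\<close> by (simp add: t_def)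
  moreover have "x$1 = p$1" using assms(2) True \<open>p$2 \<noteq> q$2\<close> by (simp add: orient_def)
  ultimately show ?thesis using True
    by (intro that[of t]) (simp add: vector_2_eq_iff algebra_simps)
next
  case False
  define t where "t = (x$1 - p$1) / (q$1 - p$1)"
  have t: "t * (q$1 - p$1) = x$1 - p$1" using False by (simp add: t_def)
  have "(q$1 - p$1) * (x$2 - p$2) = (q$1 - p$1) * (t * (q$2 - p$2))"
    using assms(2) by (simp add: orient_def mult_ac flip: t)
  then have "t * (q$2 - p$2) = x$2 - p$2" using False by simp
  then show ?thesis using t
    by (intro that[of t]) (simp add: vector_2_eq_iff algebra_simps)
qed

text \<open>
  If \<open>x\<close> were on the line but outside the segment, one of \<open>a\<close> and \<open>b\<close> would lie strictly between two
  points of \<open>E\<close>.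
\<close>

lemma on_line_in_segment:
  assumes ab: "a extreme_point_of E" "b extreme_point_of E" "a \<noteq> b" and x: "x \<in> E" "orient a b x = 0"
  shows "x \<in> closed_segment a b"
proof -
  obtain t where t: "x = (1 - t) *\<^sub>R a + t *\<^sub>R b" using orient_zero_on_line[OF ab(3) x(2)] .
  have E: "a \<in> E" "b \<in> E" using ab by (auto simp: extreme_point_of_def)
  have "\<not> t > 1"
  proof
    assume "t > 1"
    then have "b = (1 - 1 / t) *\<^sub>R a + (1 / t) *\<^sub>R x" "a \<noteq> x"
      using ab(3) by (auto simp: t vector_2_eq_iff field_simps)
    then have "b \<in> open_segment a x" using \<open>t > 1\<close> by (auto simp: in_segment intro!: exI[of _ "1 / t"])
    then show False using ab(2) E x by (auto simp: extreme_point_of_def)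
  qed
  moreover have "\<not> t < 0"
  proof
    assume "t < 0"
    define s where "s = - t / (1 - t)"
    have s: "0 < s" "s < 1" "(1 - s) * (1 - t) = 1" "(1 - s) * t + s = 0"
      using \<open>t < 0\<close> by (auto simp: s_def field_simps)
    have "(1 - s) *\<^sub>R x + s *\<^sub>R b = ((1 - s) * (1 - t)) *\<^sub>R a + ((1 - s) * t + s) *\<^sub>R b"
      by (simp add: t algebra_simps)
    then have "a = (1 - s) *\<^sub>R x + s *\<^sub>R b" by (simp only: s) simp
    moreover have "x \<noteq> b" using calculation ab(3) s by (auto simp: algebra_simps)
    ultimately have "a \<in> open_segment x b" using s by (auto simp: in_segment intro!: exI[of _ s])
    then show False using ab(1) E x by (auto simp: extreme_point_of_def)
  qed
  ultimately show ?thesis by (auto simp: in_segment t intro!: exI[of _ t])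
qed

lemma orient_extreme_nonzero:
  assumes "a extreme_point_of E" "b extreme_point_of E" "c extreme_point_of E" "distinct [a, b, c]"
  shows "orient a b c \<noteq> 0"
proof
  assume "orient a b c = 0"
  then have "c \<in> closed_segment a b"
    using on_line_in_segment[of a E b c] assms by (auto simp: extreme_point_of_def)
  then have "c \<in> open_segment a b" using assms(4) by (auto simp: open_segment_def)
  then show False using assms by (auto simp: extreme_point_of_def)
qed

text \<open>
  If \<open>c\<close> and \<open>d\<close> were on opposite sides of the line through \<open>a\<close> and \<open>b\<close>, the segment from \<open>c\<close> to \<open>d\<close>
  would cross the edge, and as the edge is a face it would contain \<open>c\<close>.
\<close>

lemma edge_same_side:
  assumes E: "convex E"
    and ext: "a extreme_point_of E" "b extreme_point_of E" "c extreme_point_of E" "d extreme_point_of E"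
    and dist: "distinct [a, b, c, d]" and edge: "closed_segment a b edge_of E"
  shows "orient a b c * orient a b d > 0"
proof (rule ccontr)
  have nz: "orient a b c \<noteq> 0" "orient a b d \<noteq> 0"
    using orient_extreme_nonzero[OF ext(1,2,3)] orient_extreme_nonzero[OF ext(1,2,4)] dist by auto
  assume "\<not> ?thesis"
  then have opp: "orient a b c * orient a b d < 0" using nz by (simp add: not_less order_less_le)
  define s where "s = orient a b c / (orient a b c - orient a b d)"
  have s: "0 < s" "s < 1" "(1 - s) * orient a b c + s * orient a b d = 0"
    using opp nz by (auto simp: s_def field_simps mult_less_0_iff zero_less_mult_iff)
  define x where "x = (1 - s) *\<^sub>R c + s *\<^sub>R d"
  have cd: "c \<in> E" "d \<in> E" using ext by (auto simp: extreme_point_of_def)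
  have x: "x \<in> open_segment c d" using s dist by (auto simp: x_def in_segment)
  have "x \<in> E" using E cd s by (auto simp: x_def convex_alt)
  moreover have "orient a b x = 0" using s by (simp add: x_def orient_affine)
  ultimately have "x \<in> closed_segment a b" using on_line_in_segment[OF ext(1,2)] dist by auto
  then have "c \<in> closed_segment a b"
    using edge x cd by (auto simp: edge_of_def face_of_def)
  then obtain u where "c = (1 - u) *\<^sub>R a + u *\<^sub>R b" by (auto simp: in_segment)
  then have "orient a b c = 0" by (simp add: orient_affine)
  then show False using nz by simp
qed

text \<open>
  The determinant is a convex combination of its values at the four vertices of the square, each of
  which is, up to a positive factor, the signed area of a triangle of consecutive vertices of \<open>E\<close>.
  For the surjectivity, the segment from \<open>F (-1, s)\<close> to \<open>F (1, s)\<close> sweeps over \<open>E\<close> as \<open>s\<close> runs from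
  \<open>-1\<close> to \<open>1\<close>: a given point \<open>x\<close> of \<open>E\<close> is on different sides of it at the two ends, hence on its line
  for some \<open>s\<close>, and between its endpoints because \<open>x\<close> is on the inner side of the edges \<open>d a\<close> and
  \<open>b c\<close>.
\<close>

lemma convex_quadrilateral_chart:
  assumes quad: "convex_quadrilateral a b c d E" and F: "F = bilin_map a b c d"
  obtains p0 A B C \<sigma> where "bilinear_chart p0 A B C E F \<sigma>"
proof -
  have hull: "E = convex hull {a, b, c, d}" and dist: "distinct [a, b, c, d]"
    and ext: "a extreme_point_of E" "b extreme_point_of E" "c extreme_point_of E" "d extreme_point_of E"
    and edges: "closed_segment a b edge_of E" "closed_segment b c edge_of E"
     "closed_segment c d edge_of E" "closed_segment d a edge_of E"
    using quad unfolding convex_quadrilateral_def by blast+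
  have E: "convex E" unfolding hull by (rule convex_convex_hull)
  have vert: "a \<in> E" "b \<in> E" "c \<in> E" "d \<in> E" using ext by (auto simp: extreme_point_of_def)
  define \<sigma> where "\<sigma> = sgn (orient a b c)"
  have prods: "orient a b c * orient a b d > 0" "orient b c d * orient a b c > 0"
     "orient c d a * orient b c d > 0"
    using edge_same_side[OF E ext(1,2,3,4) _ edges(1)] edge_same_side[OF E ext(2,3,4,1) _ edges(2)]
      edge_same_side[OF E ext(3,4,1,2) _ edges(3)] dist orient_rotate[of a b c] orient_rotate[of b c d] by auto
  then have o: "\<sigma> * orient a b c > 0" "\<sigma> * orient a b d > 0" "\<sigma> * orient b c d > 0" "\<sigma> * orient c d a > 0"
    by (auto simp: \<sigma>_def sgn_if zero_less_mult_iff)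
  then have o': "\<sigma> * orient d a b > 0" "\<sigma> * orient d a c > 0" "\<sigma> * orient b c a > 0" "\<sigma> * orient c d b > 0"
    using orient_rotate[of a b d] orient_rotate[of b d a] orient_rotate[of c d a] orient_rotate[of a b c] orient_rotate[of b c d] by simp_all
  have side: "\<sigma> * orient p q x \<ge> 0" 
    if "x \<in> E" "\<sigma> * orient p q a \<ge> 0" "\<sigma> * orient p q b \<ge> 0" "\<sigma> * orient p q c \<ge> 0" "\<sigma> * orient p q d \<ge> 0" for p q x
  proof -
    have "convex {x. \<sigma> * orient p q x \<ge> 0}"
      unfolding convex_def
    proof (clarify)
      fix x y :: "real^2" and u v :: real
      assume *: "0 \<le> \<sigma> * orient p q x" "0 \<le> \<sigma> * orient p q y" "0 \<le> u" "0 \<le> v" "u + v = 1"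
      have "\<sigma> * orient p q (u *\<^sub>R x + v *\<^sub>R y) = u * (\<sigma> * orient p q x) + v * (\<sigma> * orient p q y)"
        by (simp add: orient_affine[OF *(5)] algebra_simps)
      then show "0 \<le> \<sigma> * orient p q (u *\<^sub>R x + v *\<^sub>R y)" using * by simp
    qed
    then have "E \<subseteq> {x. \<sigma> * orient p q x \<ge> 0}"
      unfolding hull using that(2-5) by (intro hull_minimal) auto
    then show ?thesis using that(1) by blast
  qed
  have F_eq: "F y = ((1 - y$2) / 2) *\<^sub>R (((1 - y$1) / 2) *\<^sub>R a + ((1 + y$1) / 2) *\<^sub>R b)
      + ((1 + y$2) / 2) *\<^sub>R (((1 - y$1) / 2) *\<^sub>R d + ((1 + y$1) / 2) *\<^sub>R c)" for y
    by (simp add: F bilin_map_def vector_2_eq_iff field_simps)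
  have "bilinear_chart ((1/4) *\<^sub>R (a + b + c + d)) ((1/4) *\<^sub>R (b + c - a - d)) ((1/4) *\<^sub>R (c + d - a - b))
      ((1/4) *\<^sub>R (a + c - b - d)) E F \<sigma>"
  proof
    show "F = (\<lambda>y. (1/4) *\<^sub>R (a + b + c + d) + y$1 *\<^sub>R (1/4) *\<^sub>R (b + c - a - d)
        + y$2 *\<^sub>R (1/4) *\<^sub>R (c + d - a - b) + (y$1 * y$2) *\<^sub>R (1/4) *\<^sub>R (a + c - b - d))"
      by (simp add: F bilin_map_def fun_eq_iff vector_2_eq_iff field_simps)
    show "convex E" by (rule E)
    show "\<bar>\<sigma>\<bar> = 1" using o(1) by (auto simp: \<sigma>_def abs_sgn_eq)
    fix y assume "y \<in> ref_square"
    then have y: "1 - y$1 \<ge> 0" "1 + y$1 \<ge> 0" "1 - y$2 \<ge> 0" "1 + y$2 \<ge> 0"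
      by (auto simp: ref_square_def)
    define w1 w2 w3 w4 where w: "w1 = (1 - y$1) * (1 - y$2)" "w2 = (1 + y$1) * (1 - y$2)"
      "w3 = (1 + y$1) * (1 + y$2)" "w4 = (1 - y$1) * (1 + y$2)"
    have w0: "w1 \<ge> 0" "w2 \<ge> 0" "w3 \<ge> 0" "w4 \<ge> 0" "w1 + w2 + w3 + w4 = 4"
      unfolding w by (intro mult_nonneg_nonneg y)+ (simp add: algebra_simps)
    have "16 * (\<sigma> * bilin_det ((1/4) *\<^sub>R (b + c - a - d)) ((1/4) *\<^sub>R (c + d - a - b)) ((1/4) *\<^sub>R (a + c - b - d)) y)
      = \<sigma> * bilin_det (b + c - a - d) (c + d - a - b) (a + c - b - d) y"
      by (simp add: bilin_det_def algebra_simps)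
    also have "bilin_det (b + c - a - d) (c + d - a - b) (a + c - b - d) y
      = w1 * orient a b d + w2 * orient a b c + w3 * orient b c d + w4 * orient c d a"
      unfolding bilin_det_def orient_def w vector_add_component vector_minus_component by algebra
    also have "\<sigma> * \<dots> = w1 * (\<sigma> * orient a b d) + w2 * (\<sigma> * orient a b c) + w3 * (\<sigma> * orient b c d) + w4 * (\<sigma> * orient c d a)"
      by (simp add: algebra_simps)
    finally have "16 * (\<sigma> * bilin_det ((1/4) *\<^sub>R (b + c - a - d)) ((1/4) *\<^sub>R (c + d - a - b)) ((1/4) *\<^sub>R (a + c - b - d)) y)
      = w1 * (\<sigma> * orient a b d) + w2 * (\<sigma> * orient a b c) + w3 * (\<sigma> * orient b c d) + w4 * (\<sigma> * orient c d a)" .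
    moreover have "\<dots> > 0"
    proof -
      have "w1 > 0 \<or> w2 > 0 \<or> w3 > 0 \<or> w4 > 0" using w0 by linarith
      have wk: "w * k \<ge> 0 \<and> (w > 0 \<longrightarrow> w * k > 0)" if "w \<ge> 0" "k > 0" for w k :: real
        using that by simp
      show ?thesis
        using \<open>w1 > 0 \<or> w2 > 0 \<or> w3 > 0 \<or> w4 > 0\<close>
          wk[OF w0(1) o(2)] wk[OF w0(2) o(1)] wk[OF w0(3) o(3)] wk[OF w0(4) o(4)] by linarith
    qed
    ultimately show "0 < \<sigma> * bilin_det ((1/4) *\<^sub>R (b + c - a - d)) ((1/4) *\<^sub>R (c + d - a - b)) ((1/4) *\<^sub>R (a + c - b - d)) y"
      by linarith
  next
    show "F ` ref_square = E"
    proof (intro equalityI subsetI)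
      fix x assume "x \<in> F ` ref_square"
      then obtain y where y: "y \<in> ref_square" "x = F y" by blast
      show "x \<in> E" unfolding y(2) F_eq
        using y(1) by (intro convexD[OF E] vert) (auto simp: ref_square_def field_simps)
    next
      fix x assume x: "x \<in> E"
      define P where "P s = ((1 - s) / 2) *\<^sub>R a + ((1 + s) / 2) *\<^sub>R d" for s
      define Q where "Q s = ((1 - s) / 2) *\<^sub>R b + ((1 + s) / 2) *\<^sub>R c" for s
      have "\<exists>s\<ge>-1. s \<le> 1 \<and> \<sigma> * orient (P s) (Q s) x = 0"
      proof (rule IVT2')
        show "\<sigma> * orient (P 1) (Q 1) x \<le> 0"
        proof -
          have "0 \<le> \<sigma> * orient c d x" by (rule side[OF x]) (use o o' in simp_all)
          moreover have "orient d c x = - orient c d x" by (simp add: orient_def algebra_simps)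
          ultimately show ?thesis by (simp add: P_def Q_def)
        qed
        show "0 \<le> \<sigma> * orient (P (- 1)) (Q (- 1)) x"
          using side[OF x, of a b] o by (simp add: P_def Q_def)
        show "continuous_on {-1..1} (\<lambda>s. \<sigma> * orient (P s) (Q s) x)"
          unfolding orient_def P_def Q_def by (intro continuous_intros) simp_all
      qed simp
      then obtain s where s: "-1 \<le> s" "s \<le> 1" "\<sigma> * orient (P s) (Q s) x = 0" by blast
      \<comment> \<open>The endpoints lie strictly inside with respect to the opposite edge, so they are distinct.\<close>
      have Qpos: "\<sigma> * orient d a (Q s) > 0" and Ppos: "\<sigma> * orient b c (P s) > 0"
      proof -
        have comb: "u * k + v * k' > 0" if "u \<ge> 0" "v \<ge> 0" "u + v = 1" "k > 0" "k' > 0" for u v k k' :: real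
        proof (cases "u = 0")
          case False
          then show ?thesis using that by (intro add_pos_nonneg mult_pos_pos) auto
        qed (use that in auto)
        have st: "(1 - s) / 2 \<ge> 0" "(1 + s) / 2 \<ge> 0" "(1 - s) / 2 + (1 + s) / 2 = 1"
          using s by (auto simp: field_simps)
        show "\<sigma> * orient d a (Q s) > 0" "\<sigma> * orient b c (P s) > 0"
          using comb[OF st o'(1,2)] comb[OF st o'(3) o(3)]
          unfolding Q_def P_def orient_affine[OF st(3)] by (simp_all add: algebra_simps)
      qed
      have "orient d a (P s) = 0" "orient b c (Q s) = 0"
        unfolding P_def Q_def by (subst orient_affine, simp_all add: field_simps)+
      then have PQ: "P s \<noteq> Q s" using Qpos by auto
      have "orient (P s) (Q s) x = 0" using s(3) o(1) by auto
      then obtain t where t: "x = (1 - t) *\<^sub>R P s + t *\<^sub>R Q s" using orient_zero_on_line[OF PQ] by blast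
      have "0 \<le> \<sigma> * orient d a x" "0 \<le> \<sigma> * orient b c x"
        by (rule side[OF x]; use o o' in simp)+
      moreover have "orient d a x = t * orient d a (Q s)" "orient b c x = (1 - t) * orient b c (P s)"
        unfolding t by (subst orient_affine; simp add: \<open>orient d a (P s) = 0\<close> \<open>orient b c (Q s) = 0\<close>)+
      ultimately have "0 \<le> t * (\<sigma> * orient d a (Q s))" "0 \<le> (1 - t) * (\<sigma> * orient b c (P s))"
        by (simp_all add: mult.left_commute)
      then have t01: "0 \<le> t" "t \<le> 1" using Qpos Ppos by (auto simp: zero_le_mult_iff)
      have "x = F (vector [2 * t - 1, s])"
        by (simp add: t F_eq P_def Q_def vector_2_eq_iff field_simps)
      moreover have "vector [2 * t - 1, s] \<in> ref_square" using t01 s by (auto simp: ref_square_def)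
      ultimately show "x \<in> F ` ref_square" by blast
    qed
  qed
  then show thesis by (rule that)
qed

section \<open>The two sequences\<close>

theorem mainTheorem3:
  fixes a b c d :: "real^2" and E :: "(real^2) set" and F :: "real^2 \<Rightarrow> real^2" and r :: nat
  assumes "convex_quadrilateral a b c d E"
    and "F = bilin_map a b c d"
    and "r \<ge> 1"
  shows "sum_is_direct (poly_space (r + 1) E) (DS_suppl r F E) \<and>
         sum_is_direct (vec_poly_space r E) (AC_suppl r F E) \<and>
         sum_is_direct (AC_red r F E) (position_times (hom_poly_space r E)) \<and>
         exact_curl_div E (DS_map r F E) (AC_red r F E) (poly_space (r - 1) E) \<and>
         exact_curl_div E (DS_map r F E) (AC_full r F E) (poly_space r E)"
proof -
  obtain p0 A B C \<sigma> where "bilinear_chart p0 A B C E F \<sigma>"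
    using convex_quadrilateral_chart[OF assms(1,2)] .
  then interpret bilinear_chart p0 A B C E F \<sigma> .
  show ?thesis
    using assms(3) by (intro conjI direct_DS_map direct_AC_red direct_AC_full exact_AC_red exact_AC_full)
qed

end
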